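(* Let $n \in \mathbb{N}$ and let $\mathcal{S} \subseteq M_n(\mathbb{H})$ be an irreducible semigroup of matrices with spectra in $\mathbb{R}$ (equivalently, matrices whose minimal polynomials split into linear factors over $\mathbb{R}$). Then $\mathrm{Alg}_{\mathbb{R}}(\mathcal{S}) \sim M_n(\mathbb{R})$.
   Context: $\mathbb{H}$ denotes the real quaternions. Matrices in $M_n(\mathbb{H})$ act on the left of $\mathbb{H}^n$, the right $\mathbb{H}$-vector space of $n \times 1$ column vectors. A semigroup of matrices is a set of matrices closed under matrix multiplication. A semigroup $\mathcal{S} \subseteq M_n(\mathbb{H})$ is irreducible if for every nonzero $x \in \mathbb{H}^n$ the orbit $\{Sx : S \in \mathcal{S}\}$ spans $\mathbb{H}^n$ as a right $\mathbb{H}$-vector space. The spectrum of $A \in M_n(\mathbb{H})$ is the set of its right eigenvalues, i.e. of all $\lambda \in \mathbb{H}$ such that $Ax = x\lambda$ for some nonzero $x \in \mathbb{H}^n$. "With spectra in $\mathbb{R}$" means that each member of $\mathcal{S}$ has its spectrum contained in $\mathbb{R}$. Minimal polynomials are taken over $\mathbb{R}$. $\mathrm{Alg}_{\mathbb{R}}(\mathcal{S})$ is the $\mathbb{R}$-algebra generated by $\mathcal{S}$, which equals the $\mathbb{R}$-linear span of $\mathcal{S}$. For $\mathcal{A}, \mathcal{B} \subseteq M_n(\mathbb{H})$, $\mathcal{A} \sim \mathcal{B}$ means that there is an invertible $P \in M_n(\mathbb{H})$ with $\mathcal{A} = P^{-1}\mathcal{B}P = \{P^{-1}BP : B \in \mathcal{B}\}$.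 *)

theory Defs
  imports "HOL-Analysis.Analysis" "HOL-Computational_Algebra.Polynomial"
begin

section \<open>Real quaternions\<close>

codatatype quat = Quat (QRe: real) (QI: real) (QJ: real) (QK: real)

lemma quat_eqI [intro?]:
  "QRe x = QRe y \<Longrightarrow> QI x = QI y \<Longrightarrow> QJ x = QJ y \<Longrightarrow> QK x = QK y \<Longrightarrow> x = y"
  by (rule quat.expand) simp

lemma quat_eq_iff: "x = y \<longleftrightarrow> QRe x = QRe y \<and> QI x = QI y \<and> QJ x = QJ y \<and> QK x = QK y"
  by (auto intro: quat.expand)

instantiation quat :: real_vector
begin

primcorec zero_quat where
  "QRe 0 = 0" | "QI 0 = 0" | "QJ 0 = 0" | "QK 0 = 0"

primcorec plus_quat where
  "QRe (x + y) = QRe x + QRe y"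
| "QI (x + y) = QI x + QI y"
| "QJ (x + y) = QJ x + QJ y"
| "QK (x + y) = QK x + QK y"

primcorec uminus_quat where
  "QRe (- x) = - QRe x"
| "QI (- x) = - QI x"
| "QJ (- x) = - QJ x"
| "QK (- x) = - QK x"

primcorec minus_quat where
  "QRe (x - y) = QRe x - QRe y"
| "QI (x - y) = QI x - QI y"
| "QJ (x - y) = QJ x - QJ y"
| "QK (x - y) = QK x - QK y"

primcorec scaleR_quat where
  "QRe (scaleR r x) = r * QRe x"
| "QI (scaleR r x) = r * QI x"
| "QJ (scaleR r x) = r * QJ x"
| "QK (scaleR r x) = r * QK x"

instance
  by standard (simp_all add: quat_eq_iff algebra_simps)

end

definition quat_norm_sq :: "quat \<Rightarrow> real" where
  "quat_norm_sq x = (QRe x)\<^sup>2 + (QI x)\<^sup>2 + (QJ x)\<^sup>2 + (QK x)\<^sup>2"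

lemma quat_norm_sq_eq_0_iff: "quat_norm_sq x = 0 \<longleftrightarrow> x = 0"
  by (auto simp: quat_norm_sq_def quat_eq_iff add_nonneg_eq_0_iff)

text \<open>Expansion of Hamilton's relations \<open>i\<^sup>2 = j\<^sup>2 = k\<^sup>2 = i j k = -1\<close>.\<close>

instantiation quat :: real_div_algebra
begin

primcorec one_quat where
  "QRe 1 = 1" | "QI 1 = 0" | "QJ 1 = 0" | "QK 1 = 0"

primcorec times_quat where
  "QRe (x * y) = QRe x * QRe y - QI x * QI y - QJ x * QJ y - QK x * QK y"
| "QI (x * y) = QRe x * QI y + QI x * QRe y + QJ x * QK y - QK x * QJ y"
| "QJ (x * y) = QRe x * QJ y - QI x * QK y + QJ x * QRe y + QK x * QI y"
| "QK (x * y) = QRe x * QK y + QI x * QJ y - QJ x * QI y + QK x * QRe y"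

primcorec inverse_quat where
  "QRe (inverse x) = QRe x / quat_norm_sq x"
| "QI (inverse x) = - QI x / quat_norm_sq x"
| "QJ (inverse x) = - QJ x / quat_norm_sq x"
| "QK (inverse x) = - QK x / quat_norm_sq x"

definition "x div y = x * inverse y" for x y :: quat

instance
proof
  fix x y z :: quat and r :: real
  show "x * y * z = x * (y * z)" "(x + y) * z = x * z + y * z" "x * (y + z) = x * y + x * z"
    "1 * x = x" "x * 1 = x" "r *\<^sub>R x * y = r *\<^sub>R (x * y)" "x * r *\<^sub>R y = r *\<^sub>R (x * y)"
    by (simp_all add: quat_eq_iff algebra_simps)
  show "(0 :: quat) \<noteq> 1" "inverse (0 :: quat) = 0" "x div y = x * inverse y"
    by (simp_all add: quat_eq_iff divide_quat_def)
  assume "x \<noteq> 0"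
  then have nz: "quat_norm_sq x \<noteq> 0"
    by (simp add: quat_norm_sq_eq_0_iff)
  have "(QRe x * QRe x + QI x * QI x + QJ x * QJ x + QK x * QK x) / quat_norm_sq x = 1"
    using nz by (simp add: quat_norm_sq_def power2_eq_square)
  then show "inverse x * x = 1" "x * inverse x = 1"
    by (simp_all add: quat_eq_iff add_divide_distrib mult.commute)
qed

end


section \<open>Matrices over the quaternions\<close>

text \<open>
  \<open>M\<^sub>n(H)\<close> is \<^typ>\<open>quat^'n^'n\<close> with the product \<open>**\<close>; the class product \<open>*\<close> and power \<open>^\<close>
  on this type are componentwise and are not used.  The library scaling \<open>*s\<close> acts from the
  left, and its spans are for commutative scalars, so the right \<open>H\<close>-structure on
  \<open>H\<^sup>n\<close> is set up here.
\<close>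

definition right_scale :: "quat^'n \<Rightarrow> quat \<Rightarrow> quat^'n" where
  "right_scale x q = (\<chi> i. x $ i * q)"

definition right_subspace :: "(quat^'n) set \<Rightarrow> bool" where
  "right_subspace W \<longleftrightarrow>
     0 \<in> W \<and> (\<forall>x\<in>W. \<forall>y\<in>W. x + y \<in> W) \<and> (\<forall>x\<in>W. \<forall>q. right_scale x q \<in> W)"

definition right_span :: "(quat^'n) set \<Rightarrow> (quat^'n) set" where
  "right_span X = right_subspace hull X"

definition matrix_semigroup :: "(quat^'n^'n) set \<Rightarrow> bool" where
  "matrix_semigroup S \<longleftrightarrow> (\<forall>A\<in>S. \<forall>B\<in>S. A ** B \<in> S)"

definition irreducible_matrices :: "(quat^'n^'n) set \<Rightarrow> bool" where
  "irreducible_matrices S \<longleftrightarrow> (\<forall>x. x \<noteq> 0 \<longrightarrow> right_span {A *v x | A. A \<in> S} = UNIV)"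

definition right_spectrum :: "quat^'n^'n \<Rightarrow> quat set" where
  "right_spectrum A = {q. \<exists>x. x \<noteq> 0 \<and> A *v x = right_scale x q}"

text \<open>The generated algebra is not required to contain the identity matrix.\<close>

definition alg_R :: "(quat^'n^'n) set \<Rightarrow> (quat^'n^'n) set" where
  "alg_R S = (\<lambda>\<A>. subspace \<A> \<and> (\<forall>A\<in>\<A>. \<forall>B\<in>\<A>. A ** B \<in> \<A>)) hull S"

definition real_matrices :: "(quat^'n^'n) set" where
  "real_matrices = {A. \<forall>i j. A $ i $ j \<in> \<real>}"

definition similar_sets :: "(quat^'n^'n) set \<Rightarrow> (quat^'n^'n) set \<Rightarrow> bool" where
  "similar_sets \<A> \<B> \<longleftrightarrow> (\<exists>P. invertible P \<and> \<A> = {matrix_inv P ** B ** P | B. B \<in> \<B>})"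


section \<open>Minimal polynomials over the reals\<close>

definition mpow :: "quat^'n^'n \<Rightarrow> nat \<Rightarrow> quat^'n^'n" where
  "mpow A k = (((**) A) ^^ k) (mat 1)"

definition mat_eval :: "real poly \<Rightarrow> quat^'n^'n \<Rightarrow> quat^'n^'n" where
  "mat_eval p A = (\<Sum>k\<le>degree p. coeff p k *\<^sub>R mpow A k)"

definition min_poly :: "quat^'n^'n \<Rightarrow> real poly" where
  "min_poly A = (THE p. lead_coeff p = 1 \<and> mat_eval p A = 0 \<and>
     (\<forall>q. q \<noteq> 0 \<and> mat_eval q A = 0 \<longrightarrow> degree p \<le> degree q))"

definition splits_R :: "real poly \<Rightarrow> bool" where
  "splits_R p \<longleftrightarrow> (\<exists>as. p = smult (lead_coeff p) (\<Prod>a\<leftarrow>as. [:- a, 1:]))"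

text \<open>The definite description in \<^const>\<open>min_poly\<close> is meaningful.\<close>

lemma mat_eval_eq:
  assumes "degree p \<le> N"
  shows "mat_eval p A = (\<Sum>k\<le>N. coeff p k *\<^sub>R mpow A k)"
  unfolding mat_eval_def using assms
  by (intro sum.mono_neutral_left) (auto simp: coeff_eq_0)

lemma mat_eval_diff: "mat_eval (p - q) A = mat_eval p A - mat_eval q A"
  using degree_diff_le_max[of p q]
  by (simp add: mat_eval_eq[of _ "max (degree p) (degree q)"] scaleR_left_diff_distrib sum_subtractf)

lemma mat_eval_smult: "mat_eval (smult c p) A = c *\<^sub>R mat_eval p A"
  by (simp add: mat_eval_eq[of _ "degree p"] degree_smult_le scaleR_sum_right)

lemma span_finite_quat_matrices:
  "\<exists>B :: (quat^'n^'n) set. finite B \<and> span B = UNIV"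
proof -
  define Q where "Q = {Quat 1 0 0 0, Quat 0 1 0 0, Quat 0 0 1 0, Quat 0 0 0 1}"
  define E where "E = (\<lambda>(i :: 'n, j :: 'n, q :: quat). axis i (axis j q))"
  define B where "B = E ` (UNIV \<times> UNIV \<times> Q)"
  have E: "E (i, j, q) \<in> span B" for i j q
  proof -
    have q: "q = QRe q *\<^sub>R Quat 1 0 0 0 + QI q *\<^sub>R Quat 0 1 0 0
               + QJ q *\<^sub>R Quat 0 0 1 0 + QK q *\<^sub>R Quat 0 0 0 1"
      by (simp add: quat_eq_iff)
    have "E (i, j, q) = QRe q *\<^sub>R E (i, j, Quat 1 0 0 0) + QI q *\<^sub>R E (i, j, Quat 0 1 0 0)
               + QJ q *\<^sub>R E (i, j, Quat 0 0 1 0) + QK q *\<^sub>R E (i, j, Quat 0 0 0 1)"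
      by (subst q) (auto simp: E_def vec_eq_iff axis_def quat_eq_iff)
    also have "\<dots> \<in> span B"
      by (intro span_add span_scale span_base) (auto simp: B_def Q_def)
    finally show ?thesis .
  qed
  have "A \<in> span B" for A :: "quat^'n^'n"
  proof -
    have "A = (\<Sum>i\<in>UNIV. \<Sum>j\<in>UNIV. E (i, j, A $ i $ j))"
    proof -
      have "(\<Sum>k\<in>UNIV. \<Sum>l\<in>UNIV. E (k, l, A $ k $ l) $ i $ j)
          = (\<Sum>k\<in>UNIV. if i = k then A $ k $ j else 0)" for i j
        by (intro sum.cong refl) (auto simp: E_def axis_def if_distrib[of "\<lambda>v. v $ _"] cong: if_cong)
      then show ?thesis
        by (simp add: vec_eq_iff)
    qed
    also have "\<dots> \<in> span B"
      by (intro span_sum E)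
    finally show ?thesis .
  qed
  moreover have "finite B"
    by (simp add: B_def Q_def)
  ultimately show ?thesis by blast
qed

lemma ex_annihilating_poly: "\<exists>p. p \<noteq> 0 \<and> mat_eval p (A :: quat^'n^'n) = 0"
proof -
  obtain B :: "(quat^'n^'n) set" where B: "finite B" "span B = UNIV"
    using span_finite_quat_matrices by blast
  show ?thesis
  proof (cases "inj_on (mpow A) {..card B}")
    case True
    have "dependent (mpow A ` {..card B})"
      using independent_span_bound[OF B(1), of "mpow A ` {..card B}"] B(2) True
      by (auto simp: card_image)
    then obtain u where u: "\<exists>v\<in>mpow A ` {..card B}. u v \<noteq> 0"
        "(\<Sum>v\<in>mpow A ` {..card B}. u v *\<^sub>R v) = 0"
      by (auto simp: dependent_finite)
    define p where "p = (\<Sum>k\<le>card B. monom (u (mpow A k)) k)"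
    have c: "coeff p k = (if k \<le> card B then u (mpow A k) else 0)" for k
      by (simp add: p_def coeff_sum)
    have "degree p \<le> card B"
      by (intro degree_le) (simp add: c)
    then have "mat_eval p A = 0"
      using u(2) True by (simp add: mat_eval_eq c sum.reindex)
    moreover have "p \<noteq> 0"
      using u(1) c by (metis atMost_iff coeff_0 imageE)
    ultimately show ?thesis by blast
  next
    case False
    then obtain i j where ij: "i \<noteq> j" "mpow A i = mpow A j"
      by (auto simp: inj_on_def)
    have mm: "mat_eval (monom 1 k) A = mpow A k" for k
      by (simp add: mat_eval_def degree_monom_eq if_distrib[of "\<lambda>c. c *\<^sub>R _"] cong: if_cong)
    have "mat_eval (monom 1 i - monom 1 j) A = 0"
      using ij by (simp add: mat_eval_diff mm)
    moreover have "monom 1 i - monom 1 j \<noteq> (0 :: real poly)"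
      using ij by (simp add: monom_eq_iff')
    ultimately show ?thesis by blast
  qed
qed

lemma min_poly_ex1:
  "\<exists>!p. lead_coeff p = 1 \<and> mat_eval p A = 0 \<and>
     (\<forall>q. q \<noteq> 0 \<and> mat_eval q A = 0 \<longrightarrow> degree p \<le> degree q)"
proof -
  obtain p where p: "p \<noteq> 0" "mat_eval p A = 0"
      "\<And>q. q \<noteq> 0 \<Longrightarrow> mat_eval q A = 0 \<Longrightarrow> degree p \<le> degree q"
    using ex_has_least_nat[of "\<lambda>p. p \<noteq> 0 \<and> mat_eval p A = 0" _ degree] ex_annihilating_poly[of A]
    by blast
  show ?thesis
  proof (rule ex1I)
    let ?p = "smult (inverse (lead_coeff p)) p"
    show "lead_coeff ?p = 1 \<and> mat_eval ?p A = 0 \<and>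
        (\<forall>q. q \<noteq> 0 \<and> mat_eval q A = 0 \<longrightarrow> degree ?p \<le> degree q)"
      using p by (simp add: mat_eval_smult)
    fix r
    assume r: "lead_coeff r = 1 \<and> mat_eval r A = 0 \<and>
        (\<forall>q. q \<noteq> 0 \<and> mat_eval q A = 0 \<longrightarrow> degree r \<le> degree q)"
    show "r = ?p"
    proof (rule ccontr)
      assume "r \<noteq> ?p"
      then have d: "r - ?p \<noteq> 0" by simp
      have "r \<noteq> 0" using r by auto
      then have deg: "degree r = degree ?p"
        using r p by (auto intro: antisym)
      have "mat_eval (r - ?p) A = 0"
        using r p by (simp add: mat_eval_diff mat_eval_smult)
      then have "degree r \<le> degree (r - ?p)"
        using r d by blast
      moreover have "degree (r - ?p) \<le> degree r"
        using degree_diff_le_max[of r ?p] deg by simp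
      ultimately have "lead_coeff (r - ?p) = coeff r (degree r) - coeff ?p (degree r)"
        by simp
      also have "\<dots> = 0"
        using r p(1) deg by simp
      finally show False using d by (simp only: leading_coeff_0_iff)
    qed
  qed
qed

end

theory Submission
  imports Defs "HOL-Computational_Algebra.Fundamental_Theorem_Algebra"
begin

text \<open>
  The first part compares eigenvalues with roots.  If the minimal polynomial splits, evaluating it on
  an eigenvector forces the eigenvalue to be one of its roots.  If it does not split, it has a factor
  \<open>(x - a)\<^sup>2 + b\<^sup>2\<close> with \<open>b \<noteq> 0\<close>, and this factor produces an eigenvalue \<open>a + b i\<close> or
  \<open>a - b i\<close>.

  For the second part the elements of the algebra, unlike those of the semigroup, may a priori have
  nonreal spectrum.  Nor does the trace decide: on \<open>M\<^sub>n(H)\<close> only its real part is invariant under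
  conjugation, and this is real on every matrix.  The argument is topological instead.  The semigroup
  is enlarged to the closure \<open>C\<close> of its real multiples.  This is a semigroup with the same real span,
  and its members still have real spectra, because being annihilated by a fixed number of real
  linear factors is a closed condition (\<open>split_annihilates_limit\<close>).

  In \<open>C\<close> one looks at elements of minimal nonzero rank.  If \<open>X\<close> maps into the range of such an
  element without killing it, a limit of normalised powers of \<open>X\<^sup>2\<close> has minimal rank too, and so
  \<open>X\<^sup>2\<close> stretches all vectors of this range at the same rate; as the eigenvalues are
  real, \<open>X\<^sup>2\<close> is a positive scalar there (\<open>square_scalar_on_range\<close>).  This yields an idempotent \<open>E\<close> in \<open>C\<close>
  for which every nonzero element of \<open>E C E\<close> has a positive multiple of \<open>E\<close> as its square.  Elements
  with this property commute, and irreducibility then forces \<open>E C E\<close> to consist of real multiples of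
  \<open>E\<close> (\<open>corner_real\<close>); by irreducibility again \<open>E\<close> has rank one.

  Such an idempotent determines a real structure.  Write \<open>E x = u \<phi>(x)\<close> and let \<open>V\<close> be the image of
  \<open>u\<close> under the algebra.  All numbers \<open>\<phi>(A v)\<close> with \<open>v\<close> in \<open>V\<close> are real, and by irreducibility they
  determine \<open>v\<close>.  So vectors of \<open>V\<close> that are independent over the reals are independent over \<open>H\<close>,
  and a real basis of \<open>V\<close> is a right basis of \<open>H\<^sup>n\<close> in which the algebra becomes exactly
  \<open>M\<^sub>n(R)\<close> (\<open>real_form_right_basis\<close>, \<open>span_similar_real\<close>).
\<close>

section \<open>The Euclidean structure of the quaternions\<close>

instantiation quat :: euclidean_space
begin

definition inner_quat_def:
  "inner x y = QRe x * QRe y + QI x * QI y + QJ x * QJ y + QK x * QK y"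

definition norm_quat_def: "norm (x :: quat) = sqrt (inner x x)"

definition sgn_quat_def: "sgn (x :: quat) = x /\<^sub>R norm x"

definition dist_quat_def: "dist (x :: quat) y = norm (x - y)"

definition uniformity_quat_def:
  "(uniformity :: (quat \<times> quat) filter) = (INF e\<in>{0 <..}. principal {(x, y). dist x y < e})"

definition open_quat_def:
  "open (U :: quat set) \<longleftrightarrow> (\<forall>x\<in>U. eventually (\<lambda>(x', y). x' = x \<longrightarrow> y \<in> U) uniformity)"

definition Basis_quat_def:
  "Basis = {Quat 1 0 0 0, Quat 0 1 0 0, Quat 0 0 1 0, Quat 0 0 0 1}"

instance
proof
  fix x y z :: quat and r :: real
  show "inner x y = inner y x" "inner (x + y) z = inner x z + inner y z"
    "inner (r *\<^sub>R x) y = r * inner x y" "0 \<le> inner x x" "inner x x = 0 \<longleftrightarrow> x = 0"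
    by (auto simp: inner_quat_def quat_eq_iff algebra_simps add_nonneg_eq_0_iff)
next
  fix u v :: quat
  show "u \<in> Basis \<Longrightarrow> v \<in> Basis \<Longrightarrow> inner u v = (if u = v then 1 else 0)"
    unfolding Basis_quat_def by (elim insertE emptyE) (simp_all add: inner_quat_def)
  show "(\<forall>w\<in>Basis. inner u w = 0) \<longleftrightarrow> u = 0"
    by (auto simp: Basis_quat_def inner_quat_def quat_eq_iff [of u])
qed ((rule norm_quat_def sgn_quat_def dist_quat_def uniformity_quat_def open_quat_def)+,
    simp_all add: Basis_quat_def)

end

instance quat :: real_normed_div_algebra
proof
  fix x y :: quat
  have "inner (x * y) (x * y) = inner x x * inner y y"
    by (simp add: inner_quat_def algebra_simps)
  then show "norm (x * y) = norm x * norm y"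
    by (simp add: norm_quat_def real_sqrt_mult)
qed

lemma DIM_quat: "DIM(quat) = 4"
  by (simp add: Basis_quat_def)

section \<open>Quaternionic matrices as real and right-linear maps\<close>

lemma mv_scaleR: "A *v (c *\<^sub>R x) = c *\<^sub>R (A *v x)" for A :: "quat^'n^'m"
  by (simp add: linear_cmul)

lemma scaleR_mv: "(c *\<^sub>R A) *v x = c *\<^sub>R (A *v x)" for A :: "quat^'n^'m"
  by (simp add: matrix_vector_mult_def vec_eq_iff scaleR_sum_right)

lemma mm_scaleR:
  "(c *\<^sub>R A) ** B = c *\<^sub>R (A ** B)" "A ** (c *\<^sub>R B) = c *\<^sub>R (A ** B)"
  for A :: "quat^'n^'m" and B :: "quat^'k^'n"
  by (simp_all add: matrix_matrix_mult_def vec_eq_iff scaleR_sum_right)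

lemma matrix_add_rdistrib: "(A + B) ** C = A ** C + B ** C" for A B :: "quat^'n^'m"
  by (simp add: matrix_matrix_mult_def vec_eq_iff distrib_right sum.distrib)

lemma linear_mm_left: "linear (\<lambda>A. A ** B)" for B :: "quat^'k^'n"
  by (rule linearI) (simp_all add: mm_scaleR matrix_add_rdistrib)

lemma linear_mm_right: "linear (\<lambda>B. A ** B)" for A :: "quat^'n^'m"
  by (rule linearI) (simp_all add: mm_scaleR matrix_add_ldistrib)

lemma span_matrix_semigroup:
  fixes S :: "(quat^'n^'n) set"
  assumes "matrix_semigroup S"
  shows "matrix_semigroup (span S)"
proof -
  have "A ** B \<in> span S" if "A \<in> span S" "B \<in> span S" for A B
    using that
  proof (induction arbitrary: B rule: span_induct_alt)
    case base
    then show ?case by (simp add: linear_0[OF linear_mm_left] span_zero)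
  next
    case (step c A A')
    have "A ** B \<in> span S" using step.prems
    proof (induction rule: span_induct_alt)
      case base
      then show ?case by (simp add: linear_0[OF linear_mm_right] span_zero)
    next
      case (step d B B')
      then show ?case
        using \<open>A \<in> S\<close> assms
        by (simp add: matrix_add_ldistrib mm_scaleR span_add span_scale span_base
            matrix_semigroup_def)
    qed
    then show ?case
      using step by (simp add: matrix_add_rdistrib mm_scaleR span_add span_scale)
  qed
  then show ?thesis by (simp add: matrix_semigroup_def)
qed

lemma linear_mv_left: "linear (\<lambda>A. A *v x)" for x :: "quat^'n"
  by (rule linearI) (simp_all add: scaleR_mv matrix_vector_mult_add_rdistrib)

lemma mv_right_scale: "A *v right_scale x q = right_scale (A *v x) q"
  by (simp add: right_scale_def matrix_vector_mult_def vec_eq_iff sum_distrib_right mult.assoc)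

lemma right_scale_simps:
  "right_scale x (q + r) = right_scale x q + right_scale x r"
  "right_scale x (q - r) = right_scale x q - right_scale x r"
  "right_scale (x + y) q = right_scale x q + right_scale y q"
  "right_scale (x - y) q = right_scale x q - right_scale y q"
  "right_scale (right_scale x q) r = right_scale x (q * r)"
  "right_scale x (of_real c) = c *\<^sub>R x"
  "right_scale (c *\<^sub>R x) q = c *\<^sub>R right_scale x q"
  "right_scale x (c *\<^sub>R q) = c *\<^sub>R right_scale x q"
  "right_scale x 1 = x"
  "right_scale x 0 = 0"
  "right_scale 0 q = 0"
  by (simp_all add: right_scale_def vec_eq_iff algebra_simps of_real_def)

lemma right_scale_eq_0_iff: "right_scale x q = 0 \<longleftrightarrow> x = 0 \<or> q = 0"
  by (auto simp: right_scale_def vec_eq_iff)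

lemma tendsto_mm:
  fixes X :: "'a \<Rightarrow> quat^'n^'m" and Y :: "'a \<Rightarrow> quat^'k^'n"
  assumes "(X \<longlongrightarrow> L) F" "(Y \<longlongrightarrow> M) F"
  shows "((\<lambda>t. X t ** Y t) \<longlongrightarrow> L ** M) F"
  unfolding matrix_matrix_mult_def
  by (intro tendsto_vec_lambda tendsto_sum tendsto_mult tendsto_vec_nth assms)

lemma tendsto_mv:
  fixes X :: "'a \<Rightarrow> quat^'n^'m"
  assumes "(X \<longlongrightarrow> L) F" "(Y \<longlongrightarrow> y) F"
  shows "((\<lambda>t. X t *v Y t) \<longlongrightarrow> L *v y) F"
  unfolding matrix_vector_mult_def
  by (intro tendsto_vec_lambda tendsto_sum tendsto_mult tendsto_vec_nth assms)

section \<open>Matrices annihilated by real linear factors\<close>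

text \<open>
  \<open>split_annihilates X m B\<close> says that some product of \<open>m\<close> factors \<open>a X - b I\<close> with real
  \<open>(a, b) \<noteq> (0, 0)\<close>, multiplied by \<open>B\<close> from the left, is zero; for \<open>B = I\<close> it says that \<open>X\<close> is a
  root of a nonzero split real polynomial of degree at most \<open>m\<close>.  Homogeneous factors are used because
  their coefficients may be normalised to the unit circle, which is compact: this makes the
  condition closed without a bound on the eigenvalues.  A factor with \<open>a = 0\<close> is invertible.
\<close>

primrec split_annihilates :: "quat^'n^'n \<Rightarrow> nat \<Rightarrow> quat^'n^'n \<Rightarrow> bool" where
  "split_annihilates X 0 B \<longleftrightarrow> B = 0"
| "split_annihilates X (Suc m) B \<longleftrightarrow>
     (\<exists>a b. (a, b) \<noteq> (0 :: real, 0 :: real) \<and> split_annihilates X m ((a *\<^sub>R X - b *\<^sub>R mat 1) ** B))"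

lemma split_annihilates_scaleR: "split_annihilates X m B \<Longrightarrow> split_annihilates X m (c *\<^sub>R B)"
  by (induction m arbitrary: B) (auto simp: mm_scaleR)

lemma split_annihilates_0: "split_annihilates X m 0"
  by (induction m) (auto intro: exI[of _ 1])

lemma split_annihilates_mono: "split_annihilates X m B \<Longrightarrow> m \<le> k \<Longrightarrow> split_annihilates X k B"
proof (induction k rule: nat_induct)
  case (Suc k)
  show ?case
  proof (cases "m = Suc k")
    case False
    \<comment> \<open>The factor \<open>0 X + I\<close> pads the product.\<close>
    then have "split_annihilates X k ((0 *\<^sub>R X - (- 1) *\<^sub>R mat 1) ** B)" using Suc by simp
    moreover have "(0, - 1) \<noteq> (0 :: real, 0 :: real)" by simp
    ultimately show ?thesis unfolding split_annihilates.simps by blast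
  qed (use Suc in simp)
qed simp

lemma split_annihilates_scaleR_matrix:
  assumes "split_annihilates X m B"
  shows "split_annihilates (c *\<^sub>R X) m B"
proof (cases "c = 0")
  case True
  show ?thesis
  proof (cases m)
    case (Suc k)
    from True have "split_annihilates (c *\<^sub>R X) k ((1 *\<^sub>R (c *\<^sub>R X) - 0 *\<^sub>R mat 1) ** B)"
      by (simp add: split_annihilates_0)
    moreover have "(1, 0) \<noteq> (0 :: real, 0 :: real)" by simp
    ultimately show ?thesis unfolding Suc split_annihilates.simps by blast
  qed (use assms in simp)
next
  case c: False
  have "split_annihilates (c *\<^sub>R X) k B" if "split_annihilates X k B" for k B
    using that
  proof (induction k arbitrary: B)
    case (Suc k)
    then obtain a b where ab: "(a, b) \<noteq> (0, 0)" "split_annihilates X k ((a *\<^sub>R X - b *\<^sub>R mat 1) ** B)"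
      by auto
    have "split_annihilates (c *\<^sub>R X) k (c *\<^sub>R ((a *\<^sub>R X - b *\<^sub>R mat 1) ** B))"
      using Suc.IH[OF ab(2)] by (rule split_annihilates_scaleR)
    moreover have "c *\<^sub>R ((a *\<^sub>R X - b *\<^sub>R mat 1) ** B)
        = (a *\<^sub>R c *\<^sub>R X - (c * b) *\<^sub>R mat 1) ** B"
      by (simp add: mm_scaleR [symmetric] scaleR_right_diff_distrib mult.commute)
    ultimately have "split_annihilates (c *\<^sub>R X) k ((a *\<^sub>R c *\<^sub>R X - (c * b) *\<^sub>R mat 1) ** B)"
      by simp
    moreover have "(a, c * b) \<noteq> (0, 0)" using ab(1) c by simp
    ultimately show ?case unfolding split_annihilates.simps by blast
  qed simp
  then show ?thesis using assms by blast
qed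

text \<open>
  Real spectra survive limits: normalise the pairs \<open>(a, b)\<close> to the unit circle and pass to a
  convergent subsequence, one factor at a time.
\<close>

lemma split_annihilates_limit:
  assumes "X \<longlonglongrightarrow> L" "B \<longlonglongrightarrow> C" "\<And>k. split_annihilates (X k) m (B k)"
  shows "split_annihilates L m C"
  using assms
proof (induction m arbitrary: X B C)
  case 0
  then show ?case using LIMSEQ_unique[OF tendsto_const, of 0 C] by simp
next
  case (Suc m)
  have "\<exists>p\<in>sphere (0 :: real \<times> real) 1.
      split_annihilates (X k) m ((fst p *\<^sub>R X k - snd p *\<^sub>R mat 1) ** B k)" for k
  proof -
    obtain a b where ab: "(a, b) \<noteq> (0, 0)"
        "split_annihilates (X k) m ((a *\<^sub>R X k - b *\<^sub>R mat 1) ** B k)"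
      using Suc.prems(3)[of k] by auto
    define c where "c = inverse (norm (a, b))"
    have "c *\<^sub>R ((a *\<^sub>R X k - b *\<^sub>R mat 1) ** B k)
       = ((c * a) *\<^sub>R X k - (c * b) *\<^sub>R mat 1) ** B k"
      by (simp add: mm_scaleR [symmetric] scaleR_right_diff_distrib)
    with split_annihilates_scaleR[OF ab(2), of c]
    have "split_annihilates (X k) m (((c * a) *\<^sub>R X k - (c * b) *\<^sub>R mat 1) ** B k)" by simp
    moreover have "c *\<^sub>R (a, b) \<in> sphere 0 1"
    proof -
      have "norm (a, b) \<noteq> 0"
        using ab(1) by (metis norm_eq_zero zero_prod_def)
      then show ?thesis
        unfolding c_def mem_sphere_0 norm_scaleR abs_inverse abs_norm_cancel by (rule left_inverse)
    qed
    ultimately show ?thesis by (intro bexI[of _ "c *\<^sub>R (a, b)"]) auto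
  qed
  then obtain p where p: "\<And>k. p k \<in> sphere (0 :: real \<times> real) 1"
      "\<And>k. split_annihilates (X k) m ((fst (p k) *\<^sub>R X k - snd (p k) *\<^sub>R mat 1) ** B k)"
    by metis
  have "compact (sphere (0 :: real \<times> real) 1)" by simp
  then obtain q r where q: "q \<in> sphere 0 1" and r: "strict_mono r" "(p \<circ> r) \<longlonglongrightarrow> q"
    using p(1) unfolding compact_def by metis
  have X: "(X \<circ> r) \<longlonglongrightarrow> L" and B: "(B \<circ> r) \<longlonglongrightarrow> C"
    using Suc.prems(1,2) r(1) by (auto intro: LIMSEQ_subseq_LIMSEQ)
  have "split_annihilates L m ((fst q *\<^sub>R L - snd q *\<^sub>R mat 1) ** C)"
  proof (rule Suc.IH[OF X])
    show "(\<lambda>k. (fst ((p \<circ> r) k) *\<^sub>R (X \<circ> r) k - snd ((p \<circ> r) k) *\<^sub>R mat 1) ** (B \<circ> r) k)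
        \<longlonglongrightarrow> (fst q *\<^sub>R L - snd q *\<^sub>R mat 1) ** C"
      by (intro tendsto_mm tendsto_diff tendsto_scaleR tendsto_fst tendsto_snd r X B tendsto_const)
    show "split_annihilates ((X \<circ> r) k) m
        ((fst ((p \<circ> r) k) *\<^sub>R (X \<circ> r) k - snd ((p \<circ> r) k) *\<^sub>R mat 1) ** (B \<circ> r) k)" for k
      using p(2) by simp
  qed
  moreover have "(fst q, snd q) \<noteq> (0, 0)" using q by auto
  ultimately show ?case unfolding split_annihilates.simps by blast
qed

text \<open>
  Apply the factors to the vector \<open>B v\<close> one by one and stop just before the result vanishes.  The
  last nonzero vector is an eigenvector, and it lies in every invariant subspace containing \<open>B v\<close>.
\<close>

lemma split_annihilates_eigenvector:
  assumes "split_annihilates X m B" "B *v v \<noteq> 0" "B *v v \<in> Z" "subspace Z" "\<And>z. z \<in> Z \<Longrightarrow> X *v z \<in> Z"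
  shows "\<exists>e \<mu>. e \<in> Z \<and> e \<noteq> 0 \<and> X *v e = \<mu> *\<^sub>R e"
  using assms(1-3)
proof (induction m arbitrary: B)
  case (Suc m)
  then obtain a b where ab: "(a, b) \<noteq> (0, 0)" "split_annihilates X m ((a *\<^sub>R X - b *\<^sub>R mat 1) ** B)"
    by auto
  have eq: "((a *\<^sub>R X - b *\<^sub>R mat 1) ** B) *v v = a *\<^sub>R (X *v (B *v v)) - b *\<^sub>R (B *v v)"
    by (simp add: matrix_vector_mul_assoc [symmetric] matrix_vector_mult_diff_rdistrib scaleR_mv)
  show ?case
  proof (cases "((a *\<^sub>R X - b *\<^sub>R mat 1) ** B) *v v = 0")
    case True
    then have *: "a *\<^sub>R (X *v (B *v v)) = b *\<^sub>R (B *v v)"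
      using eq by simp
    then have "a \<noteq> 0" using ab(1) Suc.prems(2) by auto
    then have "X *v (B *v v) = (b / a) *\<^sub>R (B *v v)"
      using arg_cong[OF *, of "scaleR (inverse a)"] by (simp add: field_simps)
    then show ?thesis using Suc.prems by blast
  next
    case False
    then show ?thesis
      using Suc.IH[OF ab(2)] eq Suc.prems assms(4,5)
      by (simp add: subspace_diff subspace_scale)
  qed
qed simp

section \<open>Real spectrum and real minimal polynomial\<close>

lemma mat_eval_0 [simp]: "mat_eval 0 A = 0"
  by (simp add: mat_eval_def)

lemma mat_eval_pCons: "mat_eval (pCons a p) A = a *\<^sub>R mat 1 + A ** mat_eval p A"
proof -
  have "mat_eval (pCons a p) A = (\<Sum>k\<le>Suc (degree p). coeff (pCons a p) k *\<^sub>R mpow A k)"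
    by (rule mat_eval_eq) (rule degree_pCons_le)
  also have "\<dots> = a *\<^sub>R mat 1 + (\<Sum>k\<le>degree p. coeff p k *\<^sub>R (A ** mpow A k))"
    by (subst sum.atMost_Suc_shift) (simp add: mpow_def)
  also have "(\<Sum>k\<le>degree p. coeff p k *\<^sub>R (A ** mpow A k)) = A ** mat_eval p A"
    by (simp add: mat_eval_def linear_sum [OF linear_mm_right] mm_scaleR)
  finally show ?thesis .
qed

lemma mat_eval_add: "mat_eval (p + q) A = mat_eval p A + mat_eval q A"
  using mat_eval_diff[of p "smult (- 1) q" A] mat_eval_smult[of "- 1" q A] by simp

lemma mat_eval_mult: "mat_eval (p * q) A = mat_eval p A ** mat_eval q A"
  by (induction p)
    (simp_all add: mat_eval_add mat_eval_smult mat_eval_pCons matrix_add_rdistrib mm_scaleR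
      matrix_mul_assoc)

lemma mat_eval_linear: "mat_eval [:- a, 1:] A = A - a *\<^sub>R mat 1"
  by (simp add: mat_eval_pCons)

lemma min_poly:
  shows min_poly_monic: "lead_coeff (min_poly A) = 1"
    and mat_eval_min_poly: "mat_eval (min_poly A) A = 0"
    and min_poly_le: "q \<noteq> 0 \<Longrightarrow> mat_eval q A = 0 \<Longrightarrow> degree (min_poly A) \<le> degree q"
  using theI'[OF min_poly_ex1[of A]] unfolding min_poly_def by auto

lemma min_poly_linear_factors:
  assumes "splits_R (min_poly A)"
  obtains as where "min_poly A = (\<Prod>a\<leftarrow>as. [:- a, 1:])"
  using assms unfolding splits_R_def min_poly_monic smult_1_left by blast

text \<open>
  A bound on the degree that is uniform over all matrices: it allows the same number of factors
  along a convergent sequence.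
\<close>

lemma degree_min_poly_le: "degree (min_poly A) \<le> DIM(quat^'n^'n)"
  for A :: "quat^'n^'n"
proof (rule ccontr)
  let ?N = "DIM(quat^'n^'n)"
  assume "\<not> ?thesis"
  then have small: "p = 0" if "degree p \<le> ?N" "mat_eval p A = 0" for p
    using min_poly_le[of p A] that by fastforce
  have inj: "inj_on (mpow A) {..?N}"
  proof (rule inj_onI, rule ccontr)
    fix i j assume ij: "i \<in> {..?N}" "j \<in> {..?N}" "mpow A i = mpow A j" "i \<noteq> j"
    have mm: "mat_eval (monom 1 k) A = mpow A k" for k
      by (simp add: mat_eval_def degree_monom_eq if_distrib[of "\<lambda>c. c *\<^sub>R _"] cong: if_cong)
    have "monom 1 i - monom 1 j = (0 :: real poly)"
    proof (rule small)
      show "degree (monom 1 i - monom 1 j :: real poly) \<le> ?N"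
        using ij(1,2) by (intro degree_diff_le)
            (simp_all only: degree_monom_eq one_neq_zero not_False_eq_True atMost_iff)
      show "mat_eval (monom 1 i - monom 1 j) A = 0"
        using ij(3) by (simp add: mat_eval_diff mm)
    qed
    with ij show False by (simp add: monom_eq_iff')
  qed
  have "dependent (mpow A ` {..?N})"
    using independent_bound[of "mpow A ` {..?N}"] inj by (auto simp: card_image)
  then obtain u where u: "\<exists>v\<in>mpow A ` {..?N}. u v \<noteq> 0" "(\<Sum>v\<in>mpow A ` {..?N}. u v *\<^sub>R v) = 0"
    by (auto simp: dependent_finite)
  define p where "p = (\<Sum>k\<le>?N. monom (u (mpow A k)) k)"
  have c: "coeff p k = (if k \<le> ?N then u (mpow A k) else 0)" for k
    by (simp add: p_def coeff_sum)
  have "degree p \<le> ?N"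
    by (intro degree_le) (simp add: c)
  moreover from this have "mat_eval p A = 0"
    using u(2) inj by (simp add: mat_eval_eq c sum.reindex)
  ultimately have "p = 0" by (rule small)
  with u(1) c show False by (metis atMost_iff coeff_0 imageE)
qed

lemma mat_eval_linear_factors_eigenvector:
  assumes "A *v x = right_scale x q"
  shows "mat_eval (\<Prod>a\<leftarrow>as. [:- a, 1:]) A *v x = right_scale x (\<Prod>a\<leftarrow>as. q - of_real a)"
proof (induction as)
  case Nil
  then show ?case by (simp add: one_pCons mat_eval_pCons right_scale_simps)
next
  case (Cons a as)
  then show ?case
    by (simp add: mat_eval_mult mat_eval_linear matrix_vector_mul_assoc [symmetric]
        matrix_vector_mult_diff_rdistrib scaleR_mv mv_right_scale assms right_scale_simps
        left_diff_distrib of_real_def del: mult_pCons_left)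
qed

text \<open>
  An eigenvector for \<open>q\<close> turns the minimal polynomial into a vanishing product of factors
  \<open>q - a\<close> in the division ring of quaternions.
\<close>

lemma splits_imp_real_spectrum:
  assumes "splits_R (min_poly A)"
  shows "right_spectrum A \<subseteq> \<real>"
proof
  fix q assume "q \<in> right_spectrum A"
  then obtain x where x: "x \<noteq> 0" "A *v x = right_scale x q"
    by (auto simp: right_spectrum_def)
  obtain as where as: "min_poly A = (\<Prod>a\<leftarrow>as. [:- a, 1:])"
    using assms by (rule min_poly_linear_factors)
  have "right_scale x (\<Prod>a\<leftarrow>as. q - of_real a) = 0"
    using mat_eval_linear_factors_eigenvector[OF x(2), of as] mat_eval_min_poly[of A] as by simp
  then have "(\<Prod>a\<leftarrow>as. q - of_real a) = 0"
    using x(1) by (simp add: right_scale_eq_0_iff)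
  then show "q \<in> \<real>"
    by (auto simp: prod_list_zero_iff)
qed

text \<open>
  With \<open>q = a + b i\<close> and its conjugate \<open>r\<close>, the hypothesis factorises as \<open>A y = y r\<close> for
  \<open>y = A x - x q\<close>.  So \<open>r\<close> is an eigenvalue if \<open>y\<close> is nonzero, and \<open>q\<close> is one otherwise.
\<close>

lemma quadratic_factor_nonreal_eigenvalue:
  assumes "b \<noteq> 0" "x \<noteq> 0" and eq: "mat_eval [:a\<^sup>2 + b\<^sup>2, - 2 * a, 1:] A *v x = 0"
  shows "\<not> right_spectrum A \<subseteq> \<real>"
proof -
  let ?q = "Quat a b 0 0" and ?r = "Quat a (- b) 0 0"
  have nr: "?q \<notin> \<real>" "?r \<notin> \<real>"
    using assms(1) by (auto simp: Reals_def of_real_def quat_eq_iff)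
  define y where "y = A *v x - right_scale x ?q"
  have "mat_eval [:a\<^sup>2 + b\<^sup>2, - 2 * a, 1:] A *v x
      = (a\<^sup>2 + b\<^sup>2) *\<^sub>R x + A *v ((- 2 * a) *\<^sub>R x + A *v x)"
    by (simp add: mat_eval_pCons matrix_vector_mult_add_rdistrib scaleR_mv
      matrix_vector_mult_diff_rdistrib matrix_vector_mul_assoc [symmetric]
      del: scaleR_left_distrib)
  with eq have 2: "A *v (A *v x) = (2 * a) *\<^sub>R (A *v x) - (a\<^sup>2 + b\<^sup>2) *\<^sub>R x"
    by (simp only: matrix_vector_right_distrib mv_scaleR) (simp add: algebra_simps mv_scaleR)
  have s: "?q + ?r = of_real (2 * a)" "?q * ?r = of_real (a\<^sup>2 + b\<^sup>2)"
    by (simp_all add: quat_eq_iff of_real_def power2_eq_square)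
  have "right_scale (A *v x) ?q + right_scale (A *v x) ?r = (2 * a) *\<^sub>R (A *v x)"
    using right_scale_simps(1)[of "A *v x" ?q ?r] unfolding s right_scale_simps by simp
  moreover have "right_scale (right_scale x ?q) ?r = (a\<^sup>2 + b\<^sup>2) *\<^sub>R x"
    unfolding right_scale_simps s ..
  ultimately have "A *v y = right_scale y ?r"
    unfolding y_def matrix_vector_mult_diff_distrib 2 mv_right_scale right_scale_simps(4)
    by (simp add: algebra_simps)
  then have "y \<noteq> 0 \<Longrightarrow> ?r \<in> right_spectrum A"
    by (auto simp: right_spectrum_def)
  moreover have "y = 0 \<Longrightarrow> ?q \<in> right_spectrum A"
    using assms(2) by (auto simp: right_spectrum_def y_def)
  ultimately have "?r \<in> right_spectrum A \<or> ?q \<in> right_spectrum A" by blast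
  with nr show ?thesis by blast
qed

lemma poly_map_of_real_add:
  "poly (map_poly of_real (p + q)) z = poly (map_poly of_real p) z + poly (map_poly of_real q) (z :: complex)"
  by (induction p q rule: poly_induct2) (simp_all add: map_poly_pCons algebra_simps)

lemma poly_map_of_real_mult:
  "poly (map_poly of_real (p * q)) z = poly (map_poly of_real p) z * poly (map_poly of_real q) (z :: complex)"
proof (induction p)
  case (pCons a p)
  have "poly (map_poly of_real (smult a q)) z = of_real a * poly (map_poly of_real q) z"
    by (induction q) (simp_all add: map_poly_pCons algebra_simps)
  with pCons show ?case
    by (simp add: map_poly_pCons poly_map_of_real_add algebra_simps)
qed simp

lemma nonreal_root_imp_quadratic_dvd:
  assumes "poly (map_poly of_real p) (Complex a b) = 0" "b \<noteq> 0"
  shows "[:a\<^sup>2 + b\<^sup>2, - 2 * a, 1:] dvd p"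
proof -
  let ?d = "[:a\<^sup>2 + b\<^sup>2, - 2 * a, 1:]"
  define r where "r = p mod ?d"
  have d0: "poly (map_poly of_real ?d) (Complex a b) = 0"
    by (simp add: map_poly_pCons complex_eq_iff power2_eq_square algebra_simps)
  have "poly (map_poly of_real (p div ?d * ?d + r)) (Complex a b) = 0"
    using assms(1) unfolding r_def div_mult_mod_eq .
  then have r0: "poly (map_poly of_real r) (Complex a b) = 0"
    unfolding poly_map_of_real_add poly_map_of_real_mult d0 by simp
  have "r = 0 \<or> degree r < 2"
    using degree_mod_less[of ?d p] by (simp add: r_def numeral_2_eq_2)
  then have "degree r \<le> 1" by auto
  obtain c s where cs: "r = pCons c s" by (rule pCons_cases)
  with \<open>degree r \<le> 1\<close> have "degree s = 0" by (simp split: if_splits)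
  then obtain e where ce: "r = [:c, e:]" using cs degree_eq_zeroE by metis
  from r0 assms(2) have "e = 0" "c = 0"
    by (auto simp: ce map_poly_pCons complex_eq_iff)
  then show ?thesis
    using ce by (simp add: r_def mod_eq_0_iff_dvd)
qed

lemma splits_R_if_no_quadratic_factor:
  assumes "p \<noteq> 0" "\<And>a b. b \<noteq> 0 \<Longrightarrow> \<not> [:a\<^sup>2 + b\<^sup>2, - 2 * a, 1:] dvd p"
  shows "splits_R p"
  using assms
proof (induction "degree p" arbitrary: p rule: less_induct)
  case less
  show ?case
  proof (cases "degree p = 0")
    case True
    then obtain c where "p = [:c:]" by (rule degree_eq_zeroE)
    then show ?thesis unfolding splits_R_def by (intro exI[of _ "[]"]) simp
  next
    case False
    let ?c = "map_poly of_real p :: complex poly"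
    have "degree ?c = degree p" by (rule degree_map_poly) simp
    then have "\<not> constant (poly ?c)"
      using False by (simp add: constant_degree)
    then obtain z where z: "poly ?c z = 0"
      using fundamental_theorem_of_algebra by blast
    then have "Im z = 0"
      using nonreal_root_imp_quadratic_dvd[of p "Re z" "Im z"] less.prems(2) by auto
    then have "z = of_real (Re z)" by (simp add: complex_eq_iff)
    moreover have "poly ?c (of_real t) = of_real (poly p t)" for t
      by (induction p) (simp_all add: map_poly_pCons)
    ultimately have "poly p (Re z) = 0"
      using z by (metis of_real_eq_0_iff)
    then obtain q where q: "p = [:- Re z, 1:] * q"
      by (auto simp: poly_eq_0_iff_dvd)
    with less.prems(1) have q0: "q \<noteq> 0" by auto
    have "degree q < degree p"
      unfolding q using q0 by (subst degree_mult_eq) auto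
    moreover have "\<not> [:a\<^sup>2 + b\<^sup>2, - 2 * a, 1:] dvd q" if "b \<noteq> 0" for a b
      using less.prems(2)[OF that] unfolding q by (metis dvd_mult)
    ultimately obtain as where as: "q = smult (lead_coeff q) (\<Prod>a\<leftarrow>as. [:- a, 1:])"
      using less.hyps[of q] q0 unfolding splits_R_def by blast
    have "lead_coeff p = lead_coeff q"
      unfolding q by (subst lead_coeff_mult) simp
    moreover have "p = [:- Re z, 1:] * smult (lead_coeff q) (\<Prod>a\<leftarrow>as. [:- a, 1:])"
      unfolding as [symmetric] by (rule q)
    ultimately have "p = smult (lead_coeff p) (\<Prod>a\<leftarrow>Re z # as. [:- a, 1:])"
      by (simp only: list.map prod_list.Cons mult_smult_right)
    then show ?thesis unfolding splits_R_def by blast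
  qed
qed

text \<open>
  A quadratic factor \<open>d\<close> of the minimal polynomial without real roots would kill some nonzero
  vector, namely one in the range of the complementary factor \<open>s\<close>, which is nonzero at \<open>A\<close>
  by minimality.
\<close>

lemma real_spectrum_imp_splits:
  assumes "right_spectrum A \<subseteq> \<real>"
  shows "splits_R (min_poly A)"
proof (rule splits_R_if_no_quadratic_factor)
  show ne: "min_poly A \<noteq> 0" using min_poly_monic[of A] by auto
  fix a b :: real
  assume b: "b \<noteq> 0"
  let ?d = "[:a\<^sup>2 + b\<^sup>2, - 2 * a, 1:]"
  show "\<not> ?d dvd min_poly A"
  proof
    assume "?d dvd min_poly A"
    then obtain s where s: "min_poly A = ?d * s" by (elim dvdE)
    with ne have s0: "s \<noteq> 0" by auto
    have "degree s < degree (min_poly A)"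
      unfolding s using s0 by (subst degree_mult_eq) auto
    then have "mat_eval s A \<noteq> 0"
      using min_poly_le[OF s0] by force
    then obtain v where v: "mat_eval s A *v v \<noteq> 0"
      by (metis matrix_eq matrix_vector_mult_0)
    have "mat_eval ?d A *v (mat_eval s A *v v) = 0"
      using mat_eval_min_poly[of A] unfolding s mat_eval_mult matrix_vector_mul_assoc by simp
    from quadratic_factor_nonreal_eigenvalue[OF b v this] assms show False by contradiction
  qed
qed

theorem real_spectrum_iff_splits: "right_spectrum A \<subseteq> \<real> \<longleftrightarrow> splits_R (min_poly A)"
  by (rule iffI) (erule real_spectrum_imp_splits, erule splits_imp_real_spectrum)

lemma real_spectrum_split_annihilates:
  fixes A :: "quat^'n^'n"
  assumes "right_spectrum A \<subseteq> \<real>"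
  shows "split_annihilates A DIM(quat^'n^'n) (mat 1)"
proof -
  obtain as where as: "min_poly A = (\<Prod>a\<leftarrow>as. [:- a, 1:])"
    using real_spectrum_imp_splits[OF assms] by (rule min_poly_linear_factors)
  have "degree (\<Prod>a\<leftarrow>as. [:- a, 1 :: real:]) = length as"
  proof (induction as)
    case (Cons a as)
    have "(\<Prod>a\<leftarrow>as. [:- a, 1 :: real:]) \<noteq> 0"
      by (auto simp: prod_list_zero_iff)
    with Cons show ?case by (simp add: degree_mult_eq del: mult_pCons_left)
  qed simp
  then have le: "length as \<le> DIM(quat^'n^'n)"
    using degree_min_poly_le[of A] as by simp
  have "split_annihilates A (length as) (mat_eval q A)"
    if "mat_eval ((\<Prod>a\<leftarrow>as. [:- a, 1:]) * q) A = 0" for q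
    using that
  proof (induction as arbitrary: q)
    case (Cons a as)
    have "split_annihilates A (length as) (mat_eval ([:- a, 1:] * q) A)"
      using Cons.prems by (intro Cons.IH) (simp add: mult_ac del: mult_pCons_left mult_pCons_right)
    then have "split_annihilates A (length as) ((1 *\<^sub>R A - a *\<^sub>R mat 1) ** mat_eval q A)"
      by (simp add: mat_eval_mult mat_eval_linear del: mult_pCons_left)
    moreover have "(1, a) \<noteq> (0 :: real, 0)" by simp
    ultimately have "split_annihilates A (Suc (length as)) (mat_eval q A)"
      unfolding split_annihilates.simps by blast
    then show ?case by simp
  qed simp
  from this[of 1] have "split_annihilates A (length as) (mat 1)"
    using mat_eval_min_poly[of A] as by (simp add: one_pCons mat_eval_pCons)
  then show ?thesis using le by (rule split_annihilates_mono)
qed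

section \<open>The real corner of a closed irreducible cone\<close>

lemma power_subseq_limit_pos:
  fixes c l :: real
  assumes "0 \<le> c" "strict_mono r" "(\<lambda>j. c ^ Suc (r j)) \<longlonglongrightarrow> l" "0 < l"
  shows "c = 1"
proof (rule ccontr)
  assume "c \<noteq> 1"
  have r: "filterlim (\<lambda>j. Suc (r j)) at_top sequentially"
    using filterlim_subseq[OF assms(2)] by (rule filterlim_compose[OF filterlim_Suc])
  show False
  proof (cases "c < 1")
    case True
    then have "(\<lambda>k. c ^ k) \<longlonglongrightarrow> 0"
      using assms(1) by (intro LIMSEQ_realpow_zero)
    then have "(\<lambda>j. c ^ Suc (r j)) \<longlonglongrightarrow> 0"
      using r by (rule filterlim_compose)
    with assms(3,4) LIMSEQ_unique show False by fastforce
  next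
    case False
    with \<open>c \<noteq> 1\<close> have "filterlim (\<lambda>k. c ^ k) at_infinity sequentially"
      by (intro filterlim_realpow_sequentially_gt1) auto
    then have "filterlim (\<lambda>j. c ^ Suc (r j)) at_infinity sequentially"
      using r by (rule filterlim_compose)
    with assms(3) show False
      using not_tendsto_and_filterlim_at_infinity trivial_limit_sequentially by blast
  qed
qed

text \<open>
  The closure of the set of real multiples of an irreducible semigroup with real spectra is of
  this kind.  Closedness makes limits of normalised powers available.
\<close>

locale closed_split_cone =
  fixes C :: "(quat^'n^'n) set" and N :: nat
  assumes mult_closed: "A \<in> C \<Longrightarrow> B \<in> C \<Longrightarrow> A ** B \<in> C"
    and scale_closed: "A \<in> C \<Longrightarrow> c *\<^sub>R A \<in> C"
    and closed_cone: "closed C"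
    and split: "A \<in> C \<Longrightarrow> split_annihilates A N (mat 1)"
    and irreducible: "x \<noteq> 0 \<Longrightarrow> right_subspace U \<Longrightarrow> (\<And>A. A \<in> C \<Longrightarrow> A *v x \<in> U) \<Longrightarrow> U = UNIV"
begin

lemma irreducible_ker:
  assumes "x \<noteq> 0" "\<And>A. A \<in> C \<Longrightarrow> M *v (A *v x) = 0"
  shows "M = 0"
proof -
  have "right_subspace {y. M *v y = 0}"
    by (auto simp: right_subspace_def matrix_vector_right_distrib mv_right_scale right_scale_simps)
  from irreducible[OF assms(1) this] assms(2) have "M *v y = 0" for y
    by blast
  then show ?thesis by (simp add: matrix_eq)
qed

text \<open>
  Left multiplication by an element of the cone either kills \<open>T\<close> or is injective on the range of
  \<open>T\<close>.  This is the form in which minimality of the rank is used.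
\<close>

definition minimal :: "quat^'n^'n \<Rightarrow> bool" where
  "minimal T \<longleftrightarrow> T \<in> C \<and>
     (\<forall>X\<in>C. X ** T \<noteq> 0 \<longrightarrow> (\<forall>v. X *v (T *v v) = 0 \<longrightarrow> T *v v = 0))"

text \<open>
  Let \<open>A\<close> be a nonzero element with kernel of maximal dimension.  By irreducibility \<open>A B A \<noteq> 0\<close> for
  some \<open>B\<close>, and then \<open>B A\<close> inherits minimality from \<open>A\<close> and has a nonzero square.  In particular
  the cone does not consist of nilpotent matrices.
\<close>

lemma minimal_element:
  obtains T where "minimal T" "T ** T \<noteq> 0"
proof -
  define ker where "ker A = {v. A *v v = 0}" for A :: "quat^'n^'n"
  have sub: "subspace (ker A)" for A
    by (auto simp: ker_def subspace_def matrix_vector_right_distrib mv_scaleR)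
  obtain x :: "quat^'n" where "x \<noteq> 0"
    using that[of "\<chi> i. 1"] by (simp add: vec_eq_iff)
  obtain A0 where "A0 \<in> C" "A0 \<noteq> 0"
  proof -
    have "mat 1 \<noteq> (0 :: quat^'n^'n)" using \<open>x \<noteq> 0\<close> by (metis matrix_vector_mul_lid matrix_vector_mult_0)
    then obtain A where "A \<in> C" "A *v x \<noteq> 0"
      using irreducible_ker[of x "mat 1"] \<open>x \<noteq> 0\<close> by auto
    with that[of A] show ?thesis by (metis matrix_vector_mult_0)
  qed
  then obtain A where A: "A \<in> C" "A \<noteq> 0"
      "\<And>B. B \<in> C \<Longrightarrow> B \<noteq> 0 \<Longrightarrow> dim (ker B) \<le> dim (ker A)"
    using ex_has_greatest_nat[of "\<lambda>A. A \<in> C \<and> A \<noteq> 0" A0 "\<lambda>A. dim (ker A)" "Suc DIM(quat^'n)"]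
      dim_subset_UNIV by (metis le_imp_less_Suc)
  have inj: "A *v v = 0" if "X \<in> C" "X ** A \<noteq> 0" "X *v (A *v v) = 0" for X v
  proof -
    have "ker A \<subseteq> ker (X ** A)"
      by (auto simp: ker_def matrix_vector_mul_assoc [symmetric])
    then have "ker A = ker (X ** A)"
      using A that(1,2) by (intro subspace_dim_equal sub) (auto intro: mult_closed)
    then show ?thesis
      using that(3) by (auto simp: ker_def matrix_vector_mul_assoc)
  qed
  obtain v where v: "A *v v \<noteq> 0"
    using A(2) by (metis matrix_eq matrix_vector_mult_0)
  obtain B where B: "B \<in> C" "A *v (B *v (A *v v)) \<noteq> 0"
    using irreducible_ker[OF v, of A] A(2) by blast
  show ?thesis
  proof
    have "A ** B ** A \<noteq> 0"
      using B(2) by (metis matrix_vector_mul_assoc matrix_vector_mult_0)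
    have "B ** A \<noteq> 0"
      using B(2) by (metis matrix_vector_mul_assoc matrix_vector_mult_0 matrix_vector_mult_0_right)
    have "(B ** A ** (B ** A)) *v v \<noteq> 0"
    proof
      assume "(B ** A ** (B ** A)) *v v = 0"
      then have "B *v (A *v (B *v (A *v v))) = 0" by (simp add: matrix_vector_mul_assoc matrix_mul_assoc)
      then have "A *v (B *v (A *v v)) = 0" by (rule inj[OF B(1) \<open>B ** A \<noteq> 0\<close>])
      with B(2) show False ..
    qed
    then show "B ** A ** (B ** A) \<noteq> 0" by auto
    have "(B ** A) *v u = 0" if X: "X \<in> C" "X ** (B ** A) \<noteq> 0" "X *v ((B ** A) *v u) = 0" for X u
    proof -
      have "A *v u = 0"
        using inj[of "X ** B" u] X B(1)
        by (simp add: matrix_vector_mul_assoc matrix_mul_assoc mult_closed)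
      then show ?thesis by (simp add: matrix_vector_mul_assoc [symmetric])
    qed
    then show "minimal (B ** A)"
      using A(1) B(1) mult_closed by (auto simp: minimal_def)
  qed
qed

text \<open>
  A normalised subsequence of the powers of \<open>X\<^sup>2\<close> converges to some \<open>L\<close>.  It commutes with \<open>X\<close>
  and its range is nonzero and lies in the range \<open>Z\<close> of \<open>T\<close>, where \<open>X\<close> is injective; hence \<open>L\<close> does
  not kill \<open>T\<close>.  By minimality \<open>L\<close> is injective on \<open>Z\<close>, and therefore all vectors of \<open>Z\<close> grow at the
  same rate under \<open>X\<^sup>2\<close>.  Hence the real eigenvalues of \<open>X\<close> on \<open>Z\<close> have equal modulus and there is
  no nontrivial Jordan block for \<open>X\<^sup>2\<close> on \<open>Z\<close>.  As the eigenvalues of \<open>X\<close> are real, their squares, and not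
  only their moduli, coincide.
\<close>

lemma square_scalar_on_range:
  assumes T: "minimal T"
    and X: "X \<in> C" "X ** T \<noteq> 0" "range ((*v) X) \<subseteq> range ((*v) T)"
  obtains \<mu> where "\<mu> > 0" "\<And>v. X *v (X *v (T *v v)) = \<mu> *\<^sub>R (T *v v)"
proof -
  define Z where "Z = range ((*v) T)"
  have subZ: "subspace Z"
    unfolding Z_def by (intro linear_subspace_image) auto
  have XZ: "X *v v \<in> Z" for v using X(3) by (auto simp: Z_def)
  have injZ: "z = 0" if "Y \<in> C" "Y ** T \<noteq> 0" "z \<in> Z" "Y *v z = 0" for Y z
    using that T by (auto simp: Z_def minimal_def)
  define P where "P = rec_nat (X ** X) (\<lambda>_ Q. X ** X ** Q)"
  have P0: "P 0 = X ** X" and PS: "P (Suc k) = X ** X ** P k" for k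
    by (simp_all add: P_def)
  have PC: "P k \<in> C" for k
    by (induction k) (auto simp: P0 PS intro!: mult_closed X)
  have comm: "X ** P k = P k ** X" for k
    by (induction k) (simp_all add: P0 PS matrix_mul_assoc, metis matrix_mul_assoc)
  have Pinj: "z = 0" if "z \<in> Z" "P k *v z = 0" for k z
    using that
  proof (induction k)
    case 0
    then have "X *v (X *v z) = 0" by (simp add: P0 matrix_vector_mul_assoc)
    with injZ[OF X(1,2)] XZ 0 show ?case by blast
  next
    case (Suc k)
    then have "X *v (X *v (P k *v z)) = 0" by (simp add: PS matrix_vector_mul_assoc matrix_mul_assoc)
    moreover have "P k *v z \<in> Z"
      by (cases k) (simp_all add: P0 PS matrix_vector_mul_assoc [symmetric] XZ)
    ultimately show ?case using injZ[OF X(1,2)] XZ Suc by blast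
  qed
  have PZ: "P k *v v \<in> Z" for k v
    by (cases k) (simp_all add: P0 PS matrix_vector_mul_assoc [symmetric] XZ)
  obtain v1 where v1: "T *v v1 \<noteq> 0"
    using X(2) by (metis matrix_eq matrix_vector_mult_0 matrix_vector_mul_assoc matrix_vector_mult_0_right)
  have v1Z: "T *v v1 \<in> Z" by (simp add: Z_def)
  define n where "n k = norm (P k)" for k
  have npos: "n k > 0" for k
    using Pinj[OF v1Z, of k] v1 by (auto simp: n_def)
  define Q where "Q k = inverse (n k) *\<^sub>R P k" for k
  have "\<forall>k. Q k \<in> sphere 0 1"
    using npos by (auto simp: Q_def n_def)
  moreover have "compact (sphere (0 :: quat^'n^'n) 1)" by (rule compact_sphere)
  ultimately obtain L r where L: "L \<in> sphere 0 1" and r: "strict_mono r" and "(Q \<circ> r) \<longlonglongrightarrow> L"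
    unfolding compact_def by meson
  then have lim: "(\<lambda>j. inverse (n (r j)) *\<^sub>R P (r j)) \<longlonglongrightarrow> L" by (simp add: o_def Q_def)
  have LC: "L \<in> C"
    by (rule closed_sequentially[OF closed_cone _ lim]) (intro scale_closed PC)
  have limv: "(\<lambda>j. inverse (n (r j)) *\<^sub>R (P (r j) *v v)) \<longlonglongrightarrow> L *v v" for v
    using tendsto_mv[OF lim tendsto_const[of v]] by (simp add: scaleR_mv)
  have LZ: "L *v v \<in> Z" for v
    by (rule closed_sequentially[OF closed_subspace[OF subZ] _ limv[of v]])
      (intro subspace_scale[OF subZ] PZ)
  have "(\<lambda>j. X ** (inverse (n (r j)) *\<^sub>R P (r j))) \<longlonglongrightarrow> X ** L"
      "(\<lambda>j. (inverse (n (r j)) *\<^sub>R P (r j)) ** X) \<longlonglongrightarrow> L ** X"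
    by (intro tendsto_mm tendsto_const lim)+
  then have XL: "X ** L = L ** X"
    by (simp add: mm_scaleR comm LIMSEQ_unique)
  have "L \<noteq> 0" using L by auto
  then obtain v2 where v2: "L *v v2 \<noteq> 0"
    by (metis matrix_eq matrix_vector_mult_0)
  then have "X *v (L *v v2) \<noteq> 0"
    using injZ[OF X(1,2) LZ] by blast
  then have "L *v (X *v v2) \<noteq> 0"
    using XL by (simp add: matrix_vector_mul_assoc)
  moreover obtain v3 where "X *v v2 = T *v v3"
    using XZ[of v2] by (auto simp: Z_def)
  ultimately have LT: "L ** T \<noteq> 0"
    by (metis matrix_vector_mul_assoc matrix_vector_mult_0)
  \<comment> \<open>Injectivity of \<open>L\<close> on \<open>Z\<close> makes the limit positive for every eigenvector.\<close>
  have growth: "\<exists>s>0. (\<lambda>j. inverse (n (r j)) * (\<eta>\<^sup>2) ^ Suc (r j)) \<longlonglongrightarrow> s"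
    if z: "z \<in> Z" "z \<noteq> 0" "X *v z = \<eta> *\<^sub>R z" for z and \<eta> :: real
  proof -
    have "P k *v z = (\<eta>\<^sup>2) ^ Suc k *\<^sub>R z" for k
      by (induction k) (simp_all add: P0 PS matrix_vector_mul_assoc [symmetric] z(3) mv_scaleR power2_eq_square algebra_simps)
    then have "(\<lambda>j. norm ((inverse (n (r j)) * (\<eta>\<^sup>2) ^ Suc (r j)) *\<^sub>R z)) \<longlonglongrightarrow> norm (L *v z)"
      using tendsto_norm[OF limv[of z]] by simp
    then have "(\<lambda>j. norm ((inverse (n (r j)) * (\<eta>\<^sup>2) ^ Suc (r j)) *\<^sub>R z) / norm z)
        \<longlonglongrightarrow> norm (L *v z) / norm z"
      using z(2) by (intro tendsto_divide tendsto_const) auto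
    moreover have "norm ((inverse (n (r j)) * (\<eta>\<^sup>2) ^ Suc (r j)) *\<^sub>R z) / norm z
        = inverse (n (r j)) * (\<eta>\<^sup>2) ^ Suc (r j)" for j
      using npos[of "r j"] z(2) by (simp add: abs_mult power_abs)
    moreover have "norm (L *v z) / norm z > 0"
      using injZ[OF LC LT z(1)] z(2) by (intro divide_pos_pos) auto
    ultimately show ?thesis by auto
  qed
  have "split_annihilates X N (mat 1)" using X(1) by (rule split)
  then obtain e \<eta> where e: "e \<in> Z" "e \<noteq> 0" "X *v e = \<eta> *\<^sub>R e"
    using split_annihilates_eigenvector[of X N "mat 1" "T *v v1" Z] v1 v1Z subZ XZ by auto
  have "\<eta> \<noteq> 0" using injZ[OF X(1,2) e(1)] e(2,3) by auto
  obtain s where s: "s > 0" "(\<lambda>j. inverse (n (r j)) * (\<eta>\<^sup>2) ^ Suc (r j)) \<longlonglongrightarrow> s"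
    using growth[OF e] by blast
  have "X *v (X *v z) - \<eta>\<^sup>2 *\<^sub>R z = 0" if "z \<in> Z" for z
  proof (rule ccontr)
    assume nz: "X *v (X *v z) - \<eta>\<^sup>2 *\<^sub>R z \<noteq> 0"
    \<comment> \<open>An eigenvector of \<open>X\<close> in the image of \<open>X\<^sup>2 - \<eta>\<^sup>2\<close> grows like \<open>e\<close>, so its eigenvalue is
      \<open>\<eta>\<close> up to sign, and it belongs to a nontrivial Jordan block of \<open>X\<^sup>2\<close>.\<close>
    define M where "M = X ** X - \<eta>\<^sup>2 *\<^sub>R mat 1"
    have M: "M *v y = X *v (X *v y) - \<eta>\<^sup>2 *\<^sub>R y" for y
      by (simp add: M_def matrix_vector_mult_diff_rdistrib matrix_vector_mul_assoc scaleR_mv)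
    define Z' where "Z' = (*v) M ` Z"
    have "subspace Z'" unfolding Z'_def by (intro linear_subspace_image subZ) auto
    moreover have "X *v y \<in> Z'" if y: "y \<in> Z'" for y
    proof -
      obtain x where "y = M *v x" using y by (auto simp: Z'_def)
      then have "X *v y = M *v (X *v x)"
        by (simp add: M matrix_vector_mult_diff_distrib mv_scaleR)
      then show ?thesis using XZ[of x] by (simp add: Z'_def)
    qed
    moreover have "mat 1 *v (M *v z) \<in> Z'" using \<open>z \<in> Z\<close> by (auto simp: Z'_def)
    ultimately obtain w \<nu> where w: "w \<in> Z'" "w \<noteq> 0" "X *v w = \<nu> *\<^sub>R w"
      using split_annihilates_eigenvector[of X N "mat 1" "M *v z" Z'] split[OF X(1)] nz by (auto simp: M)
    obtain v where v: "v \<in> Z" "w = X *v (X *v v) - \<eta>\<^sup>2 *\<^sub>R v"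
      using w(1) by (auto simp: Z'_def M)
    have "w \<in> Z" unfolding v(2) by (intro subspace_diff subspace_scale subZ XZ v)
    then obtain t where t: "t > 0" "(\<lambda>j. inverse (n (r j)) * (\<nu>\<^sup>2) ^ Suc (r j)) \<longlonglongrightarrow> t"
      using growth w by blast
    have "(\<lambda>j. inverse (n (r j)) * (\<nu>\<^sup>2) ^ Suc (r j) / (inverse (n (r j)) * (\<eta>\<^sup>2) ^ Suc (r j)))
        \<longlonglongrightarrow> t / s"
      using s t by (intro tendsto_divide) auto
    moreover have "inverse (n (r j)) * (\<nu>\<^sup>2) ^ Suc (r j) / (inverse (n (r j)) * (\<eta>\<^sup>2) ^ Suc (r j))
        = (\<nu>\<^sup>2 / \<eta>\<^sup>2) ^ Suc (r j)" for j
      using npos[of "r j"] by (simp add: power_divide)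
    ultimately have "\<nu>\<^sup>2 / \<eta>\<^sup>2 = 1"
      using s t by (intro power_subseq_limit_pos[OF _ r, of _ "t / s"]) auto
    then have "\<nu>\<^sup>2 = \<eta>\<^sup>2" using \<open>\<eta> \<noteq> 0\<close> by simp
    then have XXw: "X *v (X *v w) = \<eta>\<^sup>2 *\<^sub>R w"
      using w(3) by (simp add: mv_scaleR power2_eq_square)
    have XXv: "X *v (X *v v) = \<eta>\<^sup>2 *\<^sub>R v + w" using v(2) by simp
    have Pv: "P k *v v = (\<eta>\<^sup>2) ^ Suc k *\<^sub>R v + (real (Suc k) * (\<eta>\<^sup>2) ^ k) *\<^sub>R w" for k
    proof (induction k)
      case 0
      show ?case by (simp add: P0 XXv matrix_vector_mul_assoc [symmetric])
    next
      case (Suc k)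
      have "P (Suc k) *v v = X *v (X *v (P k *v v))"
        by (simp add: PS matrix_vector_mul_assoc matrix_mul_assoc)
      also have "\<dots> = (\<eta>\<^sup>2) ^ Suc k *\<^sub>R (\<eta>\<^sup>2 *\<^sub>R v + w) + (real (Suc k) * (\<eta>\<^sup>2) ^ k) *\<^sub>R \<eta>\<^sup>2 *\<^sub>R w"
        unfolding Suc matrix_vector_right_distrib mv_scaleR XXv XXw ..
      also have "\<dots> = (\<eta>\<^sup>2) ^ Suc (Suc k) *\<^sub>R v + ((\<eta>\<^sup>2) ^ Suc k + real (Suc k) * (\<eta>\<^sup>2) ^ k * \<eta>\<^sup>2) *\<^sub>R w"
        by (simp add: scaleR_add_right scaleR_add_left mult_ac)
      also have "(\<eta>\<^sup>2) ^ Suc k + real (Suc k) * (\<eta>\<^sup>2) ^ k * \<eta>\<^sup>2 = real (Suc (Suc k)) * (\<eta>\<^sup>2) ^ Suc k"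
        by (simp add: algebra_simps)
      finally show ?case .
    qed
    define s' where "s' j = inverse (n (r j)) * (\<eta>\<^sup>2) ^ Suc (r j)" for j
    \<comment> \<open>The left-hand side tends to infinity, the right-hand side converges.\<close>
    have eq: "real (Suc (r j)) * s' j * norm w
        = \<eta>\<^sup>2 * norm (inverse (n (r j)) *\<^sub>R (P (r j) *v v) - s' j *\<^sub>R v)" for j
    proof -
      have "inverse (n (r j)) *\<^sub>R (P (r j) *v v) - s' j *\<^sub>R v
          = (inverse (n (r j)) * (real (Suc (r j)) * (\<eta>\<^sup>2) ^ r j)) *\<^sub>R w"
        unfolding Pv s'_def by (simp add: scaleR_add_right)
      then show ?thesis
        using npos[of "r j"] by (simp add: s'_def abs_mult power_abs)
    qed
    have s': "s' \<longlonglongrightarrow> s" using s(2) by (simp add: s'_def [abs_def])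
    have "(\<lambda>j. real (Suc (r j)) * s' j * norm w) \<longlonglongrightarrow> \<eta>\<^sup>2 * norm (L *v v - s *\<^sub>R v)"
      unfolding eq by (intro tendsto_intros limv s')
    moreover have "filterlim (\<lambda>j. (s' j * norm w) * real (Suc (r j))) at_top sequentially"
    proof (rule filterlim_tendsto_pos_mult_at_top)
      show "(\<lambda>j. s' j * norm w) \<longlonglongrightarrow> s * norm w" by (intro tendsto_intros s')
      show "0 < s * norm w" using s(1) w(2) by simp
      show "filterlim (\<lambda>j. real (Suc (r j))) at_top sequentially"
        by (intro filterlim_compose[OF filterlim_real_sequentially] filterlim_compose[OF filterlim_Suc] filterlim_subseq r)
    qed
    ultimately show False
      using not_tendsto_and_filterlim_at_infinity[OF trivial_limit_sequentially] filterlim_at_top_imp_at_infinity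
      by (fastforce simp: mult_ac)
  qed
  then show ?thesis
    using that[of "\<eta>\<^sup>2"] \<open>\<eta> \<noteq> 0\<close> by (auto simp: Z_def)
qed


text \<open>
  Rescale the square of a minimal element; the scalars in the corner \<open>E C E\<close> are positive because
  they are squares of nonzero real eigenvalues.
\<close>

lemma minimal_idempotent:
  obtains E where "E \<in> C" "E \<noteq> 0" "E ** E = E"
    "\<And>A. A \<in> C \<Longrightarrow> E ** A ** E \<noteq> 0 \<Longrightarrow> \<exists>c>0. (E ** A ** E) ** (E ** A ** E) = c *\<^sub>R E"
proof -
  obtain T where minT: "minimal T" and TT: "T ** T \<noteq> 0"
    by (rule minimal_element)
  then have TC: "T \<in> C" by (simp add: minimal_def)
  obtain \<mu> where \<mu>: "\<mu> > 0" "\<And>v. T *v (T *v (T *v v)) = \<mu> *\<^sub>R (T *v v)"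
    using square_scalar_on_range[OF minT TC TT] by auto
  define E where "E = inverse \<mu> *\<^sub>R (T ** T)"
  have E: "E *v v = inverse \<mu> *\<^sub>R (T *v (T *v v))" for v
    by (simp add: E_def scaleR_mv matrix_vector_mul_assoc)
  have ET: "E *v (T *v v) = T *v v" for v
    using \<mu> by (simp add: E)
  have rangeE: "E *v v \<in> range ((*v) T)" for v
    unfolding E by (metis mv_scaleR rangeI)
  show ?thesis
  proof
    show EC: "E \<in> C" unfolding E_def by (intro scale_closed mult_closed TC)
    show "E \<noteq> 0" unfolding E_def using TT \<mu>(1) by simp
    have "E *v (E *v v) = E *v v" for v
      using rangeE[of v] ET by auto
    then show EE: "E ** E = E" by (simp add: matrix_eq matrix_vector_mul_assoc [symmetric])
    fix A assume A: "A \<in> C" "E ** A ** E \<noteq> 0"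
    define X where "X = E ** A ** E"
    have XC: "X \<in> C" unfolding X_def by (intro mult_closed EC A)
    have XE: "X ** E = X" unfolding X_def by (metis EE matrix_mul_assoc)
    have "X ** T \<noteq> 0"
    proof
      assume "X ** T = 0"
      then have "X *v (T *v v) = 0" for v by (simp add: matrix_vector_mul_assoc)
      then have "X *v (E *v v) = 0" for v using rangeE[of v] by auto
      then have "X = 0" using XE by (metis matrix_eq matrix_vector_mul_assoc matrix_vector_mult_0)
      with A(2) show False by (simp add: X_def)
    qed
    moreover have "range ((*v) X) \<subseteq> range ((*v) T)"
      unfolding X_def using rangeE by (auto simp: matrix_vector_mul_assoc [symmetric])
    ultimately obtain c where c: "c > 0" "\<And>v. X *v (X *v (T *v v)) = c *\<^sub>R (T *v v)"
      using square_scalar_on_range[OF minT XC] by metis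
    have "(X ** X) *v v = (c *\<^sub>R E) *v v" for v
    proof -
      obtain u where "E *v v = T *v u" using rangeE[of v] by auto
      moreover have "(X ** X) *v v = X *v (X *v (E *v v))"
        by (metis XE matrix_vector_mul_assoc)
      ultimately show ?thesis using c(2) by (simp add: scaleR_mv)
    qed
    then show "\<exists>c>0. (E ** A ** E) ** (E ** A ** E) = c *\<^sub>R E"
      using c(1) by (auto simp: matrix_eq X_def)
  qed
qed

text \<open>
  Up to positive scalars the nonzero elements of the corner \<open>E C E\<close> are involutions and form a group of
  exponent two.  Such a group is commutative; positivity excludes \<open>Y X = - X Y\<close>.  If some \<open>X\<close> were not a
  real multiple of \<open>E\<close>, an eigenspace of \<open>X\<close> in the range of \<open>E\<close> would be proper and
  invariant under the corner, against irreducibility.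
\<close>

lemma corner_real:
  obtains E where "E \<in> C" "E \<noteq> 0" "E ** E = E" "\<And>A. A \<in> C \<Longrightarrow> \<exists>c. E ** A ** E = c *\<^sub>R E"
proof -
  obtain E where E: "E \<in> C" "E \<noteq> 0" "E ** E = E"
    and sq: "\<And>A. A \<in> C \<Longrightarrow> E ** A ** E \<noteq> 0 \<Longrightarrow> \<exists>c>0. (E ** A ** E) ** (E ** A ** E) = c *\<^sub>R E"
    by (rule minimal_idempotent) blast
  define K where "K = {E ** A ** E | A. A \<in> C}"
  have KE: "X ** E = X" "E ** X = X" "X \<in> C" if "X \<in> K" for X
    using that unfolding K_def by (auto intro!: mult_closed E) (metis E(3) matrix_mul_assoc)+
  have KK: "X ** Y \<in> K" if "X \<in> K" "Y \<in> K" for X Y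
  proof -
    have "X ** Y = E ** (X ** Y) ** E"
      using KE that by (metis matrix_mul_assoc)
    then show ?thesis unfolding K_def using mult_closed KE that by blast
  qed
  have Ksq: "\<exists>c>0. X ** X = c *\<^sub>R E" if "X \<in> K" "X \<noteq> 0" for X
    using that sq unfolding K_def by blast
  have comm: "X ** Y = Y ** X" if X: "X \<in> K" and Y: "Y \<in> K" for X Y
  proof (cases "X = 0 \<or> Y = 0")
    case True
    then show ?thesis by (auto simp: linear_0[OF linear_mm_left] linear_0[OF linear_mm_right])
  next
    case False
    obtain a where a: "a > 0" "X ** X = a *\<^sub>R E" using Ksq X False by blast
    obtain b where b: "b > 0" "Y ** Y = b *\<^sub>R E" using Ksq Y False by blast
    have "X ** (X ** Y) ** Y = (X ** X) ** (Y ** Y)" by (simp add: matrix_mul_assoc)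
    also have "\<dots> = (a * b) *\<^sub>R E" by (simp add: a b mm_scaleR E)
    finally have "X ** (X ** Y) ** Y \<noteq> 0" using a b E by simp
    then have "X ** Y \<noteq> 0"
      by (auto simp: linear_0[OF linear_mm_left] linear_0[OF linear_mm_right])
    then obtain c where c: "c > 0" "(X ** Y) ** (X ** Y) = c *\<^sub>R E"
      using Ksq KK X Y by blast
    have "(a * b) *\<^sub>R (Y ** X) = (X ** X) ** (Y ** X) ** (Y ** Y)"
      by (simp add: a b mm_scaleR KE KK X Y mult.commute)
    also have "\<dots> = X ** ((X ** Y) ** (X ** Y)) ** Y" by (simp add: matrix_mul_assoc)
    also have "\<dots> = c *\<^sub>R (X ** Y)" by (simp add: c mm_scaleR KE X)
    finally have 1: "(a * b) *\<^sub>R (Y ** X) = c *\<^sub>R (X ** Y)" .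
    \<comment> \<open>So \<open>X\<close> and \<open>Y\<close> commute up to a positive factor; comparing squares makes it \<open>1\<close>.\<close>
    define t where "t = c / (a * b)"
    have t: "t > 0" "Y ** X = t *\<^sub>R (X ** Y)"
      using a b c arg_cong[OF 1, of "scaleR (inverse (a * b))"] by (simp_all add: t_def field_simps)
    have "(a * c) *\<^sub>R E = X ** ((X ** Y) ** (X ** Y)) ** X"
      by (simp add: c mm_scaleR KE X a mult.commute)
    also have "\<dots> = a *\<^sub>R ((Y ** X) ** (Y ** X))"
    proof -
      have "X ** ((X ** Y) ** (X ** Y)) ** X = (X ** X) ** ((Y ** X) ** (Y ** X))"
        by (simp add: matrix_mul_assoc)
      then show ?thesis by (simp add: a mm_scaleR KE KK X Y)
    qed
    also have "\<dots> = (a * (t * t * c)) *\<^sub>R E"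
      unfolding t(2) by (simp add: mm_scaleR c)
    finally have "a * c = a * (t * t * c)" using E(2) by simp
    then have "t * t = 1" using a(1) c(1) by simp
    then have "t = 1" using t(1) by (auto simp: square_eq_1_iff)
    with t(2) show ?thesis by simp
  qed
  have "\<exists>s. X = s *\<^sub>R E" if X: "X \<in> K" for X
  proof (cases "X = 0")
    case True
    then show ?thesis by (intro exI[of _ 0]) simp
  next
    case False
    obtain c where c: "c > 0" "X ** X = c *\<^sub>R E" using Ksq X False by blast
    define s where "s = sqrt c"
    have ss: "s * s = c" using c(1) by (simp add: s_def)
    show ?thesis
    proof (cases "X = (- s) *\<^sub>R E")
      case False
      then obtain v where v: "X *v v \<noteq> (- s) *\<^sub>R (E *v v)"
        by (metis matrix_eq scaleR_mv)
      define x where "x = X *v v + s *\<^sub>R (E *v v)"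
      have "x \<noteq> 0" using v unfolding x_def by (simp add: eq_neg_iff_add_eq_0)
      have XE: "X *v (E *v u) = X *v u" "E *v (X *v u) = X *v u" "E *v (E *v u) = E *v u" for u
        using KE[OF X] E(3) by (simp_all add: matrix_vector_mul_assoc)
      have XX: "X *v (X *v u) = (s * s) *\<^sub>R (E *v u)" for u
        using c(2) by (simp add: matrix_vector_mul_assoc ss scaleR_mv)
      have x: "X *v x = s *\<^sub>R x" "E *v x = x"
        unfolding x_def matrix_vector_right_distrib mv_scaleR XE XX by (simp_all add: algebra_simps)
      have "X - s *\<^sub>R E = 0"
      proof (rule irreducible_ker[OF \<open>x \<noteq> 0\<close>])
        fix A assume A: "A \<in> C"
        have "X *v (A *v x) = X *v (E *v (A *v (E *v x)))"
          by (simp add: XE x)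
        also have "\<dots> = (X ** (E ** A ** E)) *v x"
          by (simp add: matrix_vector_mul_assoc matrix_mul_assoc)
        also have "X ** (E ** A ** E) = (E ** A ** E) ** X"
          using A by (intro comm X) (auto simp: K_def)
        also have "(E ** A ** E ** X) *v x = s *\<^sub>R (E *v (A *v x))"
          by (simp add: matrix_vector_mul_assoc [symmetric] x mv_scaleR)
        finally show "(X - s *\<^sub>R E) *v (A *v x) = 0"
          by (simp add: matrix_vector_mult_diff_rdistrib scaleR_mv)
      qed
      then show ?thesis by (intro exI[of _ s]) simp
    qed blast
  qed
  then have "\<exists>c. E ** A ** E = c *\<^sub>R E" if "A \<in> C" for A
    using that unfolding K_def by blast
  with that E show ?thesis by blast
qed

end

section \<open>Right bases of the quaternionic column space\<close>

text \<open>
  The scalars do not commute and act from the right; independence and spanning are stated in terms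
  of coordinate functions \<open>q\<close>.
\<close>

definition right_basis :: "(quat^'n) set \<Rightarrow> bool" where
  "right_basis B \<longleftrightarrow> finite B \<and>
     (\<forall>q. (\<Sum>b\<in>B. right_scale b (q b)) = 0 \<longrightarrow> (\<forall>b\<in>B. q b = 0)) \<and>
     (\<forall>x. \<exists>q. x = (\<Sum>b\<in>B. right_scale b (q b)))"

lemma right_scale_sum_right: "right_scale x (\<Sum>i\<in>I. f i) = (\<Sum>i\<in>I. right_scale x (f i))"
  by (induction I rule: infinite_finite_induct) (simp_all add: right_scale_simps)

lemma right_scale_sum_left: "right_scale (\<Sum>i\<in>I. f i) q = (\<Sum>i\<in>I. right_scale (f i) q)"
  by (induction I rule: infinite_finite_induct) (simp_all add: right_scale_simps)

lemma mv_sum: "A *v (\<Sum>i\<in>I. f i) = (\<Sum>i\<in>I. A *v f i)" for A :: "quat^'n^'m"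
  by (induction I rule: infinite_finite_induct) (simp_all add: matrix_vector_right_distrib)

text \<open>
  Multiplying a right basis by the four quaternion units gives a real basis of \<open>H\<^sup>n\<close>, which has
  real dimension \<open>4 n\<close>.
\<close>

lemma card_right_basis:
  fixes B :: "(quat^'n) set"
  assumes "right_basis B"
  shows "card B = CARD('n)"
proof -
  have fin: "finite B"
    and ind: "\<And>q b. (\<Sum>b\<in>B. right_scale b (q b)) = 0 \<Longrightarrow> b \<in> B \<Longrightarrow> q b = 0"
    and spans: "\<And>x. \<exists>q. x = (\<Sum>b\<in>B. right_scale b (q b))"
    using assms unfolding right_basis_def by blast+
  define f where "f = (\<lambda>(b :: quat^'n, i :: quat). right_scale b i)"
  define R where "R = f ` (B \<times> Basis)"
  have inj: "inj_on f (B \<times> Basis)"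
  proof (rule inj_onI, clarify)
    fix b i c j
    assume b: "b \<in> B" "i \<in> Basis" and c: "c \<in> B" "j \<in> Basis" and "f (b, i) = f (c, j)"
    then have "right_scale b i - right_scale c j = 0" by (simp add: f_def)
    moreover have "(\<Sum>x\<in>B. right_scale x ((if x = b then i else 0) - (if x = c then j else 0)))
        = right_scale b i - right_scale c j"
    proof -
      have "right_scale x (if x = y then k else 0) = (if x = y then right_scale y k else 0)"
        for x y :: "quat^'n" and k by (simp add: right_scale_simps)
      with fin b c show ?thesis by (simp add: right_scale_simps sum_subtractf)
    qed
    ultimately have "x \<in> B \<Longrightarrow> (if x = b then i else 0) - (if x = c then j else 0) = 0" for x
      using ind[of "\<lambda>x. (if x = b then i else 0) - (if x = c then j else 0)"] by simp
    from this[OF b(1)] nonzero_Basis[OF b(2)] show "b = c \<and> i = j"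
      by (auto split: if_splits)
  qed
  have "independent R"
  proof (rule independent_if_scalars_zero)
    show "finite R" unfolding R_def using fin by simp
    fix g x assume g: "(\<Sum>v\<in>R. g v *\<^sub>R v) = 0" and x: "x \<in> R"
    have "(\<Sum>b\<in>B. right_scale b (\<Sum>i\<in>Basis. g (f (b, i)) *\<^sub>R i))
        = (\<Sum>b\<in>B. \<Sum>i\<in>Basis. g (f (b, i)) *\<^sub>R f (b, i))"
      by (simp add: right_scale_sum_right right_scale_simps f_def)
    also have "\<dots> = (\<Sum>v\<in>R. g v *\<^sub>R v)"
      unfolding R_def sum.reindex[OF inj] by (simp add: sum.cartesian_product)
    finally have z: "(\<Sum>i\<in>Basis. g (f (b, i)) *\<^sub>R i) = 0" if "b \<in> B" for b
      using ind[of "\<lambda>b. \<Sum>i\<in>Basis. g (f (b, i)) *\<^sub>R i"] g that by simp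
    from x obtain b i where bi: "b \<in> B" "i \<in> Basis" "x = f (b, i)" by (auto simp: R_def)
    have "g (f (b, i)) = (\<Sum>i\<in>Basis. g (f (b, i)) *\<^sub>R i) \<bullet> i"
      using bi(2) by (simp add: inner_sum_left_Basis)
    then show "g x = 0" using z bi by simp
  qed
  moreover have "x \<in> span R" for x
  proof -
    obtain q where "x = (\<Sum>b\<in>B. right_scale b (q b))" using spans by blast
    also have "\<dots> = (\<Sum>b\<in>B. right_scale b (\<Sum>i\<in>Basis. (q b \<bullet> i) *\<^sub>R i))"
      by (simp add: euclidean_representation)
    also have "\<dots> = (\<Sum>b\<in>B. \<Sum>i\<in>Basis. (q b \<bullet> i) *\<^sub>R f (b, i))"
      by (simp add: right_scale_sum_right right_scale_simps f_def)
    also have "\<dots> \<in> span R"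
      by (intro span_sum span_scale span_base) (auto simp: R_def)
    finally show ?thesis .
  qed
  ultimately have "card R = dim (UNIV :: (quat^'n) set)"
    using basis_card_eq_dim[of R UNIV] by blast
  moreover have "card R = card B * 4"
    unfolding R_def by (simp add: card_image[OF inj] card_cartesian_product DIM_quat)
  ultimately show ?thesis by (simp add: DIM_quat)
qed

text \<open>
  Real dimension gives surjectivity; the columns of the inverse are preimages of the unit vectors,
  so that the inverse is again a matrix over \<open>H\<close>.
\<close>

lemma inj_matrix_invertible:
  fixes W :: "quat^'n^'n"
  assumes "\<And>x. W *v x = 0 \<Longrightarrow> x = 0"
  shows "invertible W"
proof -
  have lin: "linear ((*v) W)" by simp
  then have "inj ((*v) W)" using assms by (simp add: linear_injective_0)
  with lin have "surj ((*v) W)" by (rule linear_inj_imp_surj)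
  then have "\<forall>j. \<exists>x. W *v x = axis j 1" by (metis surjD)
  then obtain g where g: "\<And>j. W *v g j = axis j 1" by metis
  define V where "V = (\<chi> i j. g j $ i)"
  have WV: "W ** V = mat 1"
  proof -
    have "(W ** V) $ i $ j = (W *v g j) $ i" for i j
      by (simp add: V_def matrix_matrix_mult_def matrix_vector_mult_def)
    then show ?thesis by (simp add: vec_eq_iff g axis_def mat_def)
  qed
  have "V ** W = mat 1"
  proof -
    have "W *v (V *v (W *v x) - x) = 0" for x
      by (simp add: matrix_vector_mult_diff_distrib matrix_vector_mul_assoc matrix_mul_assoc WV)
    then have "V *v (W *v x) = x" for x using assms by fastforce
    then show ?thesis by (simp add: matrix_eq matrix_vector_mul_assoc)
  qed
  with WV show ?thesis unfolding invertible_def by blast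
qed

lemma right_basis_matrix:
  fixes B :: "(quat^'n) set"
  assumes "right_basis B"
  obtains \<beta> :: "'n \<Rightarrow> quat^'n" where "bij_betw \<beta> UNIV B" "invertible (\<chi> i j. \<beta> j $ i)"
    "\<And>x. (\<chi> i j. \<beta> j $ i) *v x = (\<Sum>j\<in>UNIV. right_scale (\<beta> j) (x $ j))"
proof -
  have "finite B" using assms by (simp add: right_basis_def)
  then obtain \<beta> :: "'n \<Rightarrow> quat^'n" where \<beta>: "bij_betw \<beta> UNIV B"
    using card_right_basis[OF assms] by (metis finite_same_card_bij finite_class.finite_UNIV)
  have W: "(\<chi> i j. \<beta> j $ i) *v x = (\<Sum>j\<in>UNIV. right_scale (\<beta> j) (x $ j))" for x
    by (simp add: matrix_vector_mult_def vec_eq_iff right_scale_def)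
  have "x = 0" if "(\<chi> i j. \<beta> j $ i) *v x = 0" for x
  proof -
    have "(\<Sum>b\<in>B. right_scale b (x $ inv \<beta> b)) = (\<Sum>j\<in>UNIV. right_scale (\<beta> j) (x $ j))"
      using \<beta> by (subst sum.reindex_bij_betw[OF \<beta>, symmetric]) (simp add: bij_betw_def inv_f_f)
    also have "\<dots> = 0" using that W by simp
    finally have "\<forall>b\<in>B. x $ inv \<beta> b = 0"
      using assms unfolding right_basis_def by (elim conjE allE[of _ "\<lambda>b. x $ inv \<beta> b"]) simp
    then have "x $ j = 0" for j
      using \<beta> by (metis bij_betw_def inv_f_f rangeI)
    then show ?thesis by (simp add: vec_eq_iff)
  qed
  then have "invertible (\<chi> i j. \<beta> j $ i)" by (rule inj_matrix_invertible)
  with \<beta> W that show ?thesis by blast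
qed

lemma matrix_inv_unique:
  assumes "W ** V = mat 1" "V ** W = mat 1"
  shows "matrix_inv V = (W :: quat^'n^'n)"
proof -
  have "V ** matrix_inv V = mat 1"
    unfolding matrix_inv_def using someI_ex[of "\<lambda>A'. V ** A' = mat 1 \<and> A' ** V = mat 1"] assms by blast
  then have "W ** (V ** matrix_inv V) = W" by simp
  then show ?thesis by (simp add: matrix_mul_assoc assms(1))
qed

lemma of_real_QRe: "q \<in> \<real> \<Longrightarrow> of_real (QRe q) = q"
  by (auto elim!: Reals_cases simp: of_real_def quat_eq_iff)

section \<open>The real form attached to a real corner\<close>

text \<open>
  An idempotent \<open>E\<close> of rank one has the form \<open>E x = u \<phi>(x)\<close> with a right-linear functional \<open>\<phi>\<close>.  The
  last condition says that \<open>E A E\<close> is a real multiple of \<open>E\<close>.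
\<close>

locale real_corner =
  fixes C :: "(quat^'n^'n) set" and E u \<phi>
  assumes mult_closed: "A \<in> C \<Longrightarrow> B \<in> C \<Longrightarrow> A ** B \<in> C"
    and irreducible: "x \<noteq> 0 \<Longrightarrow> right_subspace U \<Longrightarrow> (\<And>A. A \<in> C \<Longrightarrow> A *v x \<in> U) \<Longrightarrow> U = UNIV"
    and E: "E \<in> C" and u: "u \<noteq> 0" and Eu: "E *v u = u"
    and E_rank1: "E *v x = right_scale u (\<phi> x)"
    and corner: "A \<in> C \<Longrightarrow> \<phi> (A *v u) \<in> \<real>"
begin

lemma phi_unique: "E *v x = right_scale u q \<Longrightarrow> \<phi> x = q"
  using u E_rank1[of x] right_scale_simps(2)[of u "\<phi> x" q] by (simp add: right_scale_eq_0_iff)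

lemma phi_add: "\<phi> (x + y) = \<phi> x + \<phi> y"
  and phi_scaleR: "\<phi> (c *\<^sub>R x) = c *\<^sub>R \<phi> x"
  and phi_right_scale: "\<phi> (right_scale x q) = \<phi> x * q"
  by (rule phi_unique, simp add: matrix_vector_right_distrib mv_scaleR mv_right_scale E_rank1 right_scale_simps)+

lemma linear_phi: "linear \<phi>"
  by (rule linearI) (simp_all add: phi_add phi_scaleR)

lemma corner_span: "A \<in> span C \<Longrightarrow> \<phi> (A *v u) \<in> \<real>"
proof (induction rule: span_induct_alt)
  case base
  then show ?case by (simp add: linear_0[OF linear_phi])
next
  case (step c A B)
  have "c *\<^sub>R \<phi> (A *v u) \<in> \<real>"
    unfolding scaleR_conv_of_real using corner[OF step(1)] by simp
  with step show ?case
    by (simp add: matrix_vector_mult_add_rdistrib scaleR_mv phi_add phi_scaleR)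
qed

lemma span_mult_closed: "A \<in> span C \<Longrightarrow> B \<in> span C \<Longrightarrow> A ** B \<in> span C"
  using span_matrix_semigroup[of C] mult_closed by (simp add: matrix_semigroup_def)

text \<open>
  The kernel of \<open>\<phi>\<close> is a proper right subspace, so it contains no orbit of a nonzero vector.
\<close>

lemma phi_separates:
  assumes "\<And>A. A \<in> C \<Longrightarrow> \<phi> (A *v x) = 0"
  shows "x = 0"
proof (rule ccontr)
  assume "x \<noteq> 0"
  have "right_subspace {y. \<phi> y = 0}"
    by (auto simp: right_subspace_def phi_add phi_right_scale linear_0[OF linear_phi])
  from irreducible[OF \<open>x \<noteq> 0\<close> this] assms have "\<phi> u = 0" by blast
  with Eu E_rank1[of u] u show False by (simp add: right_scale_simps)
qed

definition "real_form = (\<lambda>A. A *v u) ` span C"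

text \<open>
  Suppose that \<open>b\<^sub>1 q\<^sub>1 + \<dots> + b\<^sub>m q\<^sub>m = 0\<close> with \<open>b\<^sub>k\<close> in the real form.  Applying \<open>\<phi> A\<close> gives a
  linear relation among the \<open>q\<^sub>k\<close> with the real coefficients \<open>\<phi>(A b\<^sub>k)\<close>, hence the same relation for
  each of their four real components.  Thus \<open>\<phi> A\<close> kills the real combination of the \<open>b\<^sub>k\<close> formed
  with one component of the \<open>q\<^sub>k\<close>, for all \<open>A\<close>, and this combination is zero.
  The right span is everything because it contains the orbit of \<open>u\<close>.
\<close>

lemma real_form_right_basis:
  assumes B: "B \<subseteq> real_form" "independent B" "real_form \<subseteq> span B"
  shows "right_basis B"
proof -
  have fin: "finite B" using B(2) by (rule independent_imp_finite)
  have "q b = 0" if q: "(\<Sum>b\<in>B. right_scale b (q b)) = 0" and b: "b \<in> B" for q b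
  proof -
    have "q b \<bullet> i = 0" if i: "i \<in> Basis" for i
    proof -
      have "(\<Sum>b\<in>B. (q b \<bullet> i) *\<^sub>R b) = 0"
      proof (rule phi_separates)
        fix A assume A: "A \<in> C"
        have "\<exists>t. \<phi> (A *v b) = of_real t" if "b \<in> B" for b
        proof -
          obtain A' where "A' \<in> span C" "b = A' *v u"
            using \<open>b \<in> B\<close> B(1) by (auto simp: real_form_def)
          then have "\<phi> (A *v b) \<in> \<real>"
            using corner_span[of "A ** A'"] span_mult_closed span_base[OF A]
            by (simp add: matrix_vector_mul_assoc)
          then show ?thesis by (auto simp: Reals_def)
        qed
        then obtain t where t: "\<And>b. b \<in> B \<Longrightarrow> \<phi> (A *v b) = of_real (t b)" by metis
        have "0 = \<phi> (A *v (\<Sum>b\<in>B. right_scale b (q b)))"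
          by (simp add: q linear_0[OF linear_phi])
        also have "\<dots> = (\<Sum>b\<in>B. \<phi> (A *v b) * q b)"
          by (simp add: mv_sum linear_sum[OF linear_phi] mv_right_scale phi_right_scale)
        also have "\<dots> = (\<Sum>b\<in>B. t b *\<^sub>R q b)"
          by (intro sum.cong refl) (simp add: t scaleR_conv_of_real)
        finally have "0 = (\<Sum>b\<in>B. t b *\<^sub>R q b) \<bullet> i" by simp
        then have 0: "(\<Sum>b\<in>B. (q b \<bullet> i) * t b) = 0"
          by (simp add: inner_sum_left mult.commute)
        have "\<phi> (A *v (\<Sum>b\<in>B. (q b \<bullet> i) *\<^sub>R b)) = (\<Sum>b\<in>B. (q b \<bullet> i) *\<^sub>R \<phi> (A *v b))"
          by (simp add: mv_sum linear_sum[OF linear_phi] mv_scaleR phi_scaleR)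
        also have "\<dots> = (\<Sum>b\<in>B. of_real ((q b \<bullet> i) * t b))"
          by (intro sum.cong refl) (simp add: t scaleR_conv_of_real)
        also have "\<dots> = of_real (\<Sum>b\<in>B. (q b \<bullet> i) * t b)" by simp
        finally show "\<phi> (A *v (\<Sum>b\<in>B. (q b \<bullet> i) *\<^sub>R b)) = 0" using 0 by simp
      qed
      then show ?thesis by (rule independentD[OF B(2) fin order_refl _ b])
    qed
    then show ?thesis using euclidean_all_zero_iff by blast
  qed
  moreover have "\<exists>q. x = (\<Sum>b\<in>B. right_scale b (q b))" for x
  proof -
    define U where "U = range (\<lambda>q. \<Sum>b\<in>B. right_scale b (q b))"
    have "right_subspace U"
      unfolding right_subspace_def
    proof (intro conjI ballI allI)
      show "0 \<in> U" by (auto simp: U_def right_scale_simps intro!: range_eqI[of _ _ "\<lambda>_. 0"])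
      show "x + y \<in> U" if "x \<in> U" "y \<in> U" for x y
      proof -
        from that obtain p q where "x = (\<Sum>b\<in>B. right_scale b (p b))" "y = (\<Sum>b\<in>B. right_scale b (q b))"
          by (auto simp: U_def)
        then have "x + y = (\<Sum>b\<in>B. right_scale b (p b + q b))"
          by (simp add: right_scale_simps sum.distrib)
        then show ?thesis by (auto simp: U_def)
      qed
      show "right_scale x r \<in> U" if "x \<in> U" for x r
      proof -
        from that obtain p where "x = (\<Sum>b\<in>B. right_scale b (p b))"
          by (auto simp: U_def)
        then have "right_scale x r = (\<Sum>b\<in>B. right_scale b (p b * r))"
          by (simp add: right_scale_sum_left right_scale_simps)
        then show ?thesis by (auto simp: U_def)
      qed
    qed
    moreover have "A *v u \<in> U" if "A \<in> C" for A
    proof -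
      have "A *v u \<in> span B" using that B(3) by (auto simp: real_form_def span_base)
      then obtain c where "A *v u = (\<Sum>b\<in>B. c b *\<^sub>R b)"
        using span_finite[OF fin] by auto
      then have "A *v u = (\<Sum>b\<in>B. right_scale b (of_real (c b)))"
        by (simp add: right_scale_simps)
      then show ?thesis by (auto simp: U_def)
    qed
    ultimately have "U = UNIV" by (rule irreducible[OF u])
    then show ?thesis by (auto simp: U_def)
  qed
  ultimately show ?thesis using fin unfolding right_basis_def by blast
qed

text \<open>
  Conjugation by the matrix \<open>W\<close> of a real basis of the real form makes all elements of the algebra
  real, since they preserve the real form.  Every real matrix arises: the functionals \<open>\<phi> A\<close> exhaust
  the real dual space, as no nonzero vector is killed by all of them, and the vectors \<open>A u\<close> exhaust
  the real form, so the products \<open>K E L\<close> include all matrix units.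
\<close>

theorem span_similar_real: "similar_sets (span C) real_matrices"
proof -
  obtain B where B: "B \<subseteq> real_form" "independent B" "real_form \<subseteq> span B"
    by (rule maximal_independent_subset)
  then have fin: "finite B" by (simp add: independent_imp_finite)
  obtain \<beta> :: "'n \<Rightarrow> quat^'n" where bij: "bij_betw \<beta> UNIV B" and "invertible (\<chi> i j. \<beta> j $ i)"
    and W': "\<And>x. (\<chi> i j. \<beta> j $ i) *v x = (\<Sum>j\<in>UNIV. right_scale (\<beta> j) (x $ j))"
    using right_basis_matrix[OF real_form_right_basis[OF B]] by blast
  define W where "W = (\<chi> i j. \<beta> j $ i)"
  have W: "W *v x = (\<Sum>j\<in>UNIV. right_scale (\<beta> j) (x $ j))" for x
    using W' by (simp add: W_def)
  obtain V where V: "W ** V = mat 1" "V ** W = mat 1"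
    using \<open>invertible _\<close> unfolding W_def invertible_def by blast
  have Wcol: "(A ** W) $ i $ j = (A *v \<beta> j) $ i" for A :: "quat^'n^'n" and i j
    by (simp add: W_def matrix_matrix_mult_def matrix_vector_mult_def)
  have WM: "A ** W = W ** (\<chi> i j. of_real (m i j))"
    if "\<And>j. A *v \<beta> j = (\<Sum>i\<in>UNIV. m i j *\<^sub>R \<beta> i)" for A m
    by (simp add: vec_eq_iff Wcol that) (simp add: W_def matrix_matrix_mult_def of_real_def)
  have \<beta>_form: "\<beta> j \<in> real_form" for j
    using bij B(1) by (auto simp: bij_betw_def)
  have form_\<beta>: "\<exists>m. x = (\<Sum>i\<in>UNIV. m i *\<^sub>R \<beta> i)" if "x \<in> real_form" for x
  proof -
    have "x \<in> span B" using that B(3) by auto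
    then obtain c where "x = (\<Sum>b\<in>B. c b *\<^sub>R b)" using span_finite[OF fin] by auto
    also have "\<dots> = (\<Sum>i\<in>UNIV. c (\<beta> i) *\<^sub>R \<beta> i)"
      by (rule sum.reindex_bij_betw[OF bij, symmetric])
    finally show ?thesis by (rule exI[of _ "\<lambda>i. c (\<beta> i)"])
  qed
  have real: "\<exists>M\<in>real_matrices. A ** W = W ** M" if A: "A \<in> span C" for A
  proof -
    have "A *v \<beta> j \<in> real_form" for j
      using \<beta>_form[of j] span_mult_closed[OF A]
      by (auto simp: real_form_def matrix_vector_mul_assoc)
    then have "\<forall>j. \<exists>m. A *v \<beta> j = (\<Sum>i\<in>UNIV. m i *\<^sub>R \<beta> i)" using form_\<beta> by blast
    then obtain m where "\<And>j. A *v \<beta> j = (\<Sum>i\<in>UNIV. m j i *\<^sub>R \<beta> i)" by metis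
    then have "A ** W = W ** (\<chi> i j. of_real (m j i))" by (rule WM)
    then show ?thesis by (rule bexI) (simp add: real_matrices_def)
  qed
  have "\<phi> (A *v \<beta> j) \<in> \<real>" if "A \<in> span C" for A j
    using \<beta>_form[of j] span_mult_closed[OF that] corner_span
    by (auto simp: real_form_def matrix_vector_mul_assoc)
  then have QRe_phi: "of_real (QRe (\<phi> (A *v \<beta> j))) = \<phi> (A *v \<beta> j)" if "A \<in> span C" for A j
    using that by (intro of_real_QRe)
  define \<rho> where "\<rho> A = (\<chi> j. QRe (\<phi> (A *v \<beta> j)))" for A
  have "linear \<rho>"
    by (rule linearI)
      (simp_all add: \<rho>_def vec_eq_iff matrix_vector_mult_add_rdistrib scaleR_mv phi_add phi_scaleR)
  then have sub: "span (\<rho> ` span C) = \<rho> ` span C"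
    by (intro span_eq_iff[THEN iffD2] linear_subspace_image subspace_span)
  have surj: "\<rho> ` span C = UNIV"
  proof (rule ccontr)
    assume "\<rho> ` span C \<noteq> UNIV"
    then obtain a :: "real^'n" where a: "a \<noteq> 0" "\<And>x. x \<in> \<rho> ` span C \<Longrightarrow> a \<bullet> x = 0"
      using span_not_UNIV_orthogonal[of "\<rho> ` span C"] unfolding sub by blast
    have "(\<Sum>j\<in>UNIV. a $ j *\<^sub>R \<beta> j) = 0"
    proof (rule phi_separates)
      fix A assume "A \<in> C"
      then have A: "A \<in> span C" by (rule span_base)
      have "\<phi> (A *v (\<Sum>j\<in>UNIV. a $ j *\<^sub>R \<beta> j)) = (\<Sum>j\<in>UNIV. a $ j *\<^sub>R \<phi> (A *v \<beta> j))"
        by (simp add: mv_sum linear_sum[OF linear_phi] mv_scaleR phi_scaleR)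
      also have "\<dots> = (\<Sum>j\<in>UNIV. of_real (a $ j * QRe (\<phi> (A *v \<beta> j))))"
        by (intro sum.cong refl) (simp add: QRe_phi[OF A] scaleR_conv_of_real)
      also have "\<dots> = of_real (a \<bullet> \<rho> A)"
        by (simp add: inner_vec_def \<rho>_def)
      finally show "\<phi> (A *v (\<Sum>j\<in>UNIV. a $ j *\<^sub>R \<beta> j)) = 0" using a(2) A by simp
    qed
    then have "W *v (\<chi> j. of_real (a $ j)) = 0"
      by (simp add: W right_scale_simps)
    then have "(\<chi> j. of_real (a $ j)) = (0 :: quat^'n)"
      by (metis V(2) matrix_vector_mul_assoc matrix_vector_mul_lid matrix_vector_mult_0_right)
    with a(1) show False by (simp add: vec_eq_iff)
  qed
  have "\<exists>L. L \<in> span C \<and> (\<forall>j. \<phi> (L *v \<beta> j) = (if j = l then 1 else 0))" for l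
  proof -
    obtain L where L: "L \<in> span C" "\<rho> L = axis l 1" using surj by (metis UNIV_I imageE)
    have "\<phi> (L *v \<beta> j) = (if j = l then 1 else 0)" for j
      using QRe_phi[OF L(1), of j] arg_cong[OF L(2), of "\<lambda>v. v $ j"] by (auto simp: \<rho>_def axis_def)
    with L(1) show ?thesis by blast
  qed
  then obtain L where L: "\<And>l. L l \<in> span C" "\<And>l j. \<phi> (L l *v \<beta> j) = (if j = l then 1 else 0)"
    by metis
  have "\<exists>K. K \<in> span C \<and> K *v u = \<beta> k" for k
    using \<beta>_form[of k] unfolding real_form_def by (elim imageE) auto
  then obtain K where K: "\<And>k. K k \<in> span C" "\<And>k. K k *v u = \<beta> k" by metis
  have full: "\<exists>A\<in>span C. A ** W = W ** M" if "M \<in> real_matrices" for M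
  proof -
    have "\<forall>i j. \<exists>m. M $ i $ j = of_real m" using that by (auto simp: real_matrices_def Reals_def)
    then obtain m where m: "\<And>i j. M $ i $ j = of_real (m i j)" by metis
    define A where "A = (\<Sum>k\<in>UNIV. \<Sum>l\<in>UNIV. m k l *\<^sub>R (K k ** E ** L l))"
    have "A \<in> span C"
      unfolding A_def by (intro span_sum span_scale span_mult_closed K L span_base[OF E])
    moreover have "A *v \<beta> j = (\<Sum>i\<in>UNIV. m i j *\<^sub>R \<beta> i)" for j
    proof -
      have "A *v \<beta> j = (\<Sum>k\<in>UNIV. \<Sum>l\<in>UNIV. m k l *\<^sub>R (K k *v (E *v (L l *v \<beta> j))))"
        unfolding A_def
        by (simp add: linear_sum[OF linear_mv_left] scaleR_mv matrix_vector_mul_assoc matrix_mul_assoc)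
      also have "\<dots> = (\<Sum>k\<in>UNIV. \<Sum>l\<in>UNIV. if l = j then m k j *\<^sub>R \<beta> k else 0)"
        by (intro sum.cong refl) (auto simp: E_rank1 L(2) K(2) right_scale_simps)
      also have "\<dots> = (\<Sum>i\<in>UNIV. m i j *\<^sub>R \<beta> i)" by simp
      finally show ?thesis .
    qed
    then have "A ** W = W ** (\<chi> i j. of_real (m i j))" by (rule WM)
    moreover have "(\<chi> i j. of_real (m i j)) = M" by (simp add: vec_eq_iff m)
    ultimately show ?thesis by auto
  qed
  have conj: "A ** W = W ** M \<longleftrightarrow> A = W ** M ** V" for A M
    using V by (metis matrix_mul_assoc matrix_mul_rid)
  have "span C = {W ** M ** V | M. M \<in> real_matrices}"
    using real full unfolding conj by blast
  moreover have "matrix_inv V = W" using V by (rule matrix_inv_unique)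
  moreover have "invertible V" using V unfolding invertible_def by blast
  ultimately show ?thesis unfolding similar_sets_def by auto
qed

end

context closed_split_cone
begin

text \<open>
  The right subspace of all \<open>y\<close> with \<open>E y\<close> in \<open>u H\<close> contains the orbit of \<open>u\<close>, because the corner is
  real.  So the idempotent of \<open>corner_real\<close> has rank one.
\<close>

theorem span_similar_real: "similar_sets (span C) real_matrices"
proof -
  obtain E where E: "E \<in> C" "E \<noteq> 0" "E ** E = E" "\<And>A. A \<in> C \<Longrightarrow> \<exists>c. E ** A ** E = c *\<^sub>R E"
    using corner_real by blast
  obtain v where "E *v v \<noteq> 0" using E(2) by (metis matrix_eq matrix_vector_mult_0)
  define u where "u = E *v v"
  have u: "u \<noteq> 0" "E *v u = u"
    using \<open>E *v v \<noteq> 0\<close> E(3) by (simp_all add: u_def matrix_vector_mul_assoc)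
  have EAu: "\<exists>c :: real. E *v (A *v u) = right_scale u (of_real c)" if A: "A \<in> C" for A
  proof -
    obtain c where c: "E ** A ** E = c *\<^sub>R E" using E(4) A by blast
    have "E *v (A *v u) = (E ** A ** E) *v u"
      by (simp add: matrix_vector_mul_assoc [symmetric] u)
    then show ?thesis by (auto simp: c scaleR_mv u right_scale_simps)
  qed
  define U where "U = {y. \<exists>q. E *v y = right_scale u q}"
  have "right_subspace U"
    unfolding right_subspace_def
  proof (intro conjI ballI allI)
    show "0 \<in> U" by (auto simp: U_def right_scale_eq_0_iff intro!: exI[of _ 0])
    show "x + y \<in> U" if "x \<in> U" "y \<in> U" for x y
      using that by (auto simp: U_def matrix_vector_right_distrib right_scale_simps(1) [symmetric])
    show "right_scale x r \<in> U" if "x \<in> U" for x r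
      using that by (auto simp: U_def mv_right_scale right_scale_simps(5))
  qed
  moreover have "A *v u \<in> U" if "A \<in> C" for A
    using EAu[OF that] by (auto simp: U_def)
  ultimately have "U = UNIV" by (rule irreducible[OF u(1)])
  then have "\<forall>x. \<exists>q. E *v x = right_scale u q" by (auto simp: U_def)
  then obtain \<phi> where \<phi>: "\<And>x. E *v x = right_scale u (\<phi> x)" by metis
  interpret real_corner C E u \<phi>
  proof
    fix A assume "A \<in> C"
    then obtain c where c: "E *v (A *v u) = right_scale u (of_real c)" using EAu by blast
    have "right_scale u (\<phi> (A *v u) - of_real c) = 0"
      using c \<phi> by (simp add: right_scale_simps(2))
    then show "\<phi> (A *v u) \<in> \<real>" using u(1) by (simp add: right_scale_eq_0_iff)
  qed (fact mult_closed irreducible E(1) u \<phi>)+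
  show ?thesis by (rule span_similar_real)
qed

end

section \<open>From the semigroup to its closed cone\<close>

lemma alg_R_semigroup:
  fixes S :: "(quat^'n^'n) set"
  assumes "matrix_semigroup S"
  shows "alg_R S = span S"
  unfolding alg_R_def
proof (rule hull_unique)
  show "S \<subseteq> span S" by (rule span_superset)
  show "subspace (span S) \<and> (\<forall>A\<in>span S. \<forall>B\<in>span S. A ** B \<in> span S)"
    using span_matrix_semigroup[OF assms] by (simp add: matrix_semigroup_def)
  show "span S \<subseteq> T" if "S \<subseteq> T" "subspace T \<and> (\<forall>A\<in>T. \<forall>B\<in>T. A ** B \<in> T)" for T
    using that by (simp add: span_minimal)
qed

definition scalings :: "'a::real_vector set \<Rightarrow> 'a set" where
  "scalings S = {c *\<^sub>R A | c A. A \<in> S}"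

lemma subset_scalings: "S \<subseteq> scalings S"
proof
  fix A assume "A \<in> S"
  moreover have "A = 1 *\<^sub>R A" by simp
  ultimately show "A \<in> scalings S" unfolding scalings_def by blast
qed

text \<open>
  Real spectra are not assumed for sums, so the enlargement stops at multiples and limits; these
  keep the property by \<open>split_annihilates_limit\<close>.
\<close>

lemma closed_split_cone_closure:
  fixes S :: "(quat^'n^'n) set"
  assumes semi: "matrix_semigroup S" and irr: "irreducible_matrices S"
    and spec: "\<forall>A\<in>S. right_spectrum A \<subseteq> \<real>"
  shows "closed_split_cone (closure (scalings S)) DIM(quat^'n^'n)"
proof
  let ?K = "scalings S"
  show "closed (closure ?K)" by simp
  show "A ** B \<in> closure ?K" if AB: "A \<in> closure ?K" "B \<in> closure ?K" for A B
  proof -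
    obtain X Y where X: "\<And>k. X k \<in> ?K" "X \<longlonglongrightarrow> A" and Y: "\<And>k. Y k \<in> ?K" "Y \<longlonglongrightarrow> B"
      using AB unfolding closure_sequential by blast
    have prod: "X k ** Y k \<in> ?K" for k
    proof -
      obtain c A' d B' where "X k = c *\<^sub>R A'" "A' \<in> S" "Y k = d *\<^sub>R B'" "B' \<in> S"
        using X(1)[of k] Y(1)[of k] unfolding scalings_def by blast
      then have "X k ** Y k = (d * c) *\<^sub>R (A' ** B')" "A' ** B' \<in> S"
        using semi by (simp_all add: mm_scaleR matrix_semigroup_def)
      then show ?thesis unfolding scalings_def by blast
    qed
    show ?thesis unfolding closure_sequential
      by (intro exI[of _ "\<lambda>k. X k ** Y k"] conjI allI prod tendsto_mm X Y)
  qed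
  show "c *\<^sub>R A \<in> closure ?K" if A: "A \<in> closure ?K" for c A
  proof -
    obtain X where X: "\<And>k. X k \<in> ?K" "X \<longlonglongrightarrow> A"
      using A unfolding closure_sequential by blast
    have scale: "c *\<^sub>R X k \<in> ?K" for k
    proof -
      obtain d A' where "X k = d *\<^sub>R A'" "A' \<in> S"
        using X(1)[of k] unfolding scalings_def by blast
      then have "c *\<^sub>R X k = (c * d) *\<^sub>R A'" "A' \<in> S" by simp_all
      then show ?thesis unfolding scalings_def by blast
    qed
    show ?thesis unfolding closure_sequential
      by (intro exI[of _ "\<lambda>k. c *\<^sub>R X k"] conjI allI scale tendsto_intros X)
  qed
  show "split_annihilates A DIM(quat^'n^'n) (mat 1)" if A: "A \<in> closure ?K" for A
  proof -
    obtain X where X: "\<And>k. X k \<in> ?K" "X \<longlonglongrightarrow> A"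
      using A unfolding closure_sequential by blast
    have "split_annihilates (X k) DIM(quat^'n^'n) (mat 1)" for k
    proof -
      obtain c A' where "X k = c *\<^sub>R A'" "A' \<in> S" using X(1)[of k] unfolding scalings_def by blast
      moreover from this have "split_annihilates A' DIM(quat^'n^'n) (mat 1)"
        using spec by (intro real_spectrum_split_annihilates) auto
      ultimately show ?thesis using split_annihilates_scaleR_matrix by metis
    qed
    with X(2) tendsto_const show ?thesis by (rule split_annihilates_limit)
  qed
  fix x :: "quat^'n" and U
  assume x: "x \<noteq> 0" and U: "right_subspace U" "\<And>A. A \<in> closure ?K \<Longrightarrow> A *v x \<in> U"
  have "S \<subseteq> ?K" by (rule subset_scalings)
  then have "{A *v x | A. A \<in> S} \<subseteq> U"
    using U(2) closure_subset by blast
  then have "right_span {A *v x | A. A \<in> S} \<subseteq> U"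
    unfolding right_span_def using U(1) by (rule hull_minimal)
  with irr x show "U = UNIV" unfolding irreducible_matrices_def by blast
qed

lemma span_closure_scalings:
  fixes S :: "'a::euclidean_space set"
  shows "span (closure (scalings S)) = span S"
proof (rule antisym)
  have "scalings S \<subseteq> span S" by (auto simp: scalings_def intro: span_scale span_base)
  then have "closure (scalings S) \<subseteq> span S"
    by (rule closure_minimal) (rule closed_span)
  then show "span (closure (scalings S)) \<subseteq> span S"
    by (rule span_minimal) (rule subspace_span)
  have "S \<subseteq> scalings S" by (rule subset_scalings)
  then show "span S \<subseteq> span (closure (scalings S))"
    using closure_subset by (intro span_mono) blast
qed

theorem theorem2p5:
  fixes S :: "(quat^'n^'n) set"
  shows "(\<forall>A :: quat^'n^'n. right_spectrum A \<subseteq> \<real> \<longleftrightarrow> splits_R (min_poly A)) \<and>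
    (matrix_semigroup S \<and> irreducible_matrices S \<and> (\<forall>A\<in>S. right_spectrum A \<subseteq> \<real>)
      \<longrightarrow> similar_sets (alg_R S) real_matrices)"
proof (intro conjI allI impI)
  show "right_spectrum A \<subseteq> \<real> \<longleftrightarrow> splits_R (min_poly A)" for A :: "quat^'n^'n"
    by (rule real_spectrum_iff_splits)
  assume S: "matrix_semigroup S \<and> irreducible_matrices S \<and> (\<forall>A\<in>S. right_spectrum A \<subseteq> \<real>)"
  then interpret closed_split_cone "closure (scalings S)" "DIM(quat^'n^'n)"
    by (intro closed_split_cone_closure) auto
  show "similar_sets (alg_R S) real_matrices"
    using span_similar_real S by (simp add: span_closure_scalings alg_R_semigroup)
qed

end
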